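(* Let $V$ be a real vector space of dimension $n$ with a fixed euclidean scalar product $\cdot$. Let $g$ be a metric extensor on $V$, let $\eta$ be a pseudo-orthogonal metric extensor on $V$ with the same signature as $g$, and let $h$ be any gauge extensor for $g$ with $g=h^{\dagger}\circ\eta\circ h$. Let $\underset{g}{\ast}$ denote any one of the following products on $\bigwedge V$: the exterior product $\wedge$, the $g$-scalar product $\underset{g}{\cdot}$, the left $g$-contracted product $\underset{g}{\lrcorner}$, the right $g$-contracted product $\underset{g}{\llcorner}$, or the $g$-Clifford product; and let $\underset{\eta}{\ast}$ denote the corresponding product for $\eta$ (respectively $\wedge$, $\underset{\eta}{\cdot}$, $\underset{\eta}{\lrcorner}$, $\underset{\eta}{\llcorner}$, or the $\eta$-Clifford product). Then for all $X,Y\in\bigwedge V$ $$\underline{h}(X\underset{g}{\ast}Y)=\underline{h}(X)\underset{\eta}{\ast}\underline{h}(Y),$$ where $\underline{h}$ is the extended of $h$.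
   Context: $V$ is a real vector space with $\dim V=n$, and $\cdot$ is a fixed euclidean (positive definite) scalar product on $V$, extended to $\bigwedge V=\bigoplus_{k=0}^{n}\bigwedge^k V$ by $\alpha\cdot\beta=\alpha\beta$ for scalars, $(v_1\wedge\cdots\wedge v_k)\cdot(w_1\wedge\cdots\wedge w_k)=\det[v_i\cdot w_j]$, and with homogeneous elements of different grades being orthogonal. A $(1,1)$-extensor (operator) on $V$ is a linear map $t:V\to V$; $t^{\dagger}$ is its adjoint with respect to the euclidean scalar product: $t(v)\cdot w=v\cdot t^{\dagger}(w)$. The extended of $t$ is the unique linear map $\underline{t}:\bigwedge V\to\bigwedge V$ with $\underline{t}(\alpha)=\alpha$ for $\alpha\in\mathbb{R}$, $\underline{t}(v)=t(v)$ for $v\in V$, and $\underline{t}(X\wedge Y)=\underline{t}(X)\wedge\underline{t}(Y)$. A metric extensor is a linear map $g:V\to V$ that is symmetric ($g=g^{\dagger}$) and non-degenerate ($\det[g]\neq 0$); it corresponds to the (possibly indefinite) metric $v\underset{g}{\cdot}w=g(v)\cdot w$ on $V$. It has signature $(p,n-p)$ if it has exactly $p$ positive and $n-p$ negative eigenvalues, counted with multiplicity. A pseudo-orthogonal metric extensor is a metric extensor $\eta$ which is orthogonal with respect to the euclidean scalar product, $\eta^{\dagger}=\eta^{-1}$ (so its eigenvalues are $\pm1$). A gauge extensor for $g$ is a non-singular linear map $h:V\to V$ with $g=h^{\dagger}\circ\eta\circ h$ for some pseudo-orthogonal metric extensor $\eta$ with the same signature as $g$. Products. The euclidean left and right contracted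 products are defined by $(X\lrcorner Y)\cdot Z=Y\cdot(\widetilde{X}\wedge Z)$ and $(X\llcorner Y)\cdot Z=X\cdot(Z\wedge\widetilde{Y})$ for all $Z\in\bigwedge V$, where $\widetilde{\ }$ is reversion. For any metric extensor $g$ (and likewise for $\eta$), for all $X,Y\in\bigwedge V$: $X\underset{g}{\cdot}Y=\underline{g}(X)\cdot Y$, $X\underset{g}{\lrcorner}Y=\underline{g}(X)\lrcorner Y$, $X\underset{g}{\llcorner}Y=X\llcorner\underline{g}(Y)$. The $g$-Clifford product, written here $X\underset{g}{}Y$ (juxtaposition with a $g$ underneath), is the unique associative bilinear product on $\bigwedge V$ such that for $\alpha\in\mathbb{R}$, $v\in V$, $X\in\bigwedge V$: $\alpha\underset{g}{}X=X\underset{g}{}\alpha=\alpha X$, $v\underset{g}{}X=v\underset{g}{\lrcorner}X+v\wedge X$ and $X\underset{g}{}v=X\underset{g}{\llcorner}v+X\wedge v$. *)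

theory Defs
  imports
    "HOL-Analysis.Linear_Algebra"
    "HOL-Library.Poly_Mapping"
    "Jordan_Normal_Form.Determinant"
begin

section \<open>The exterior algebra of a real vector space\<close>

text \<open>
  The exterior algebra of V is constructed, without choosing a basis, as the free unital real
  algebra on the elements of V modulo the two-sided ideal generated by the linear relations of V
  and by all squares of vectors. The free algebra is the monoid algebra of the monoid of words
  over V; multiplication of \<open>poly_mapping\<close>s is convolution along \<open>+\<close> on the keys, which for
  words is concatenation.
\<close>

datatype 'a mword = MWord "'a list"

instantiation mword :: (type) monoid_add
begin

definition zero_mword :: "'a mword" where
  "0 = MWord []"

fun plus_mword :: "'a mword \<Rightarrow> 'a mword \<Rightarrow> 'a mword" where
  "MWord xs + MWord ys = MWord (xs @ ys)"

instance
proof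
  fix a b c :: "'a mword"
  show "a + b + c = a + (b + c)" by (cases a; cases b; cases c) simp
  show "0 + a = a" by (cases a) (simp add: zero_mword_def)
  show "a + 0 = a" by (cases a) (simp add: zero_mword_def)
qed

end

type_synonym 'a free_alg = "'a mword \<Rightarrow>\<^sub>0 real"

definition free_gen :: "'a \<Rightarrow> 'a free_alg" where
  "free_gen v = Poly_Mapping.single (MWord [v]) 1"

definition free_scalar :: "real \<Rightarrow> 'a free_alg" where
  "free_scalar c = Poly_Mapping.single 0 c"

inductive_set ext_ideal :: "'a::real_vector free_alg set" where
  rel_add: "free_gen (v + w) - free_gen v - free_gen w \<in> ext_ideal"
| rel_scale: "free_gen (c *\<^sub>R v) - free_scalar c * free_gen v \<in> ext_ideal"
| rel_square: "free_gen v * free_gen v \<in> ext_ideal"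
| ideal_zero: "0 \<in> ext_ideal"
| ideal_add: "x \<in> ext_ideal \<Longrightarrow> y \<in> ext_ideal \<Longrightarrow> x + y \<in> ext_ideal"
| ideal_mult: "x \<in> ext_ideal \<Longrightarrow> a * x * b \<in> ext_ideal"

lemma ext_ideal_mult_left: "x \<in> ext_ideal \<Longrightarrow> a * x \<in> ext_ideal"
  using ideal_mult[of x a 1] by simp

lemma ext_ideal_mult_right: "x \<in> ext_ideal \<Longrightarrow> x * b \<in> ext_ideal"
  using ideal_mult[of x 1 b] by simp

lemma ext_ideal_uminus: "x \<in> ext_ideal \<Longrightarrow> - x \<in> ext_ideal"
  using ideal_mult[of x "- 1" 1] by simp

definition ext_rel :: "'a::real_vector free_alg \<Rightarrow> 'a free_alg \<Rightarrow> bool" where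
  "ext_rel x y \<longleftrightarrow> x - y \<in> ext_ideal"

lemma ext_rel_equivp: "equivp (ext_rel :: 'a::real_vector free_alg \<Rightarrow> _)"
proof (rule equivpI)
  show "reflp (ext_rel :: 'a free_alg \<Rightarrow> _)"
    by (rule reflpI) (simp add: ext_rel_def ideal_zero)
  show "symp (ext_rel :: 'a free_alg \<Rightarrow> _)"
  proof (rule sympI)
    fix x y :: "'a free_alg" assume "ext_rel x y"
    then show "ext_rel y x" using ext_ideal_uminus[of "x - y"] by (simp add: ext_rel_def)
  qed
  show "transp (ext_rel :: 'a free_alg \<Rightarrow> _)"
  proof (rule transpI)
    fix x y z :: "'a free_alg" assume "ext_rel x y" "ext_rel y z"
    then show "ext_rel x z" using ideal_add[of "x - y" "y - z"] by (simp add: ext_rel_def)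
  qed
qed

quotient_type (overloaded) 'a multivector = "'a::real_vector free_alg" / ext_rel
  by (rule ext_rel_equivp)

lemma ext_rel_add: "ext_rel a b \<Longrightarrow> ext_rel c d \<Longrightarrow> ext_rel (a + c) (b + d)"
  using ideal_add[of "a - b" "c - d"] by (simp add: ext_rel_def algebra_simps)

lemma ext_rel_uminus: "ext_rel a b \<Longrightarrow> ext_rel (- a) (- b)"
  using ext_ideal_uminus[of "a - b"] by (simp add: ext_rel_def)

lemma ext_rel_mult:
  assumes "ext_rel a b" "ext_rel c d"
  shows "ext_rel (a * c) (b * d)"
proof -
  have "a * c - b * d = (a - b) * c + b * (c - d)"
    by (simp add: algebra_simps)
  then show ?thesis
    using assms ideal_add[OF ext_ideal_mult_right ext_ideal_mult_left]
    by (metis ext_rel_def)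
qed

lemma free_scalar_simps:
  "free_scalar (a + b) = free_scalar a + free_scalar b"
  "free_scalar (a * b) = free_scalar a * free_scalar b"
  "free_scalar 1 = 1"
  by (simp_all add: free_scalar_def single_add mult_single)

instantiation multivector :: (real_vector) real_vector
begin

lift_definition zero_multivector :: "'a multivector" is 0 .

lift_definition plus_multivector :: "'a multivector \<Rightarrow> 'a multivector \<Rightarrow> 'a multivector"
  is "(+)" by (rule ext_rel_add)

lift_definition uminus_multivector :: "'a multivector \<Rightarrow> 'a multivector"
  is uminus by (rule ext_rel_uminus)

definition minus_multivector :: "'a multivector \<Rightarrow> 'a multivector \<Rightarrow> 'a multivector" where
  "X - Y = X + - (Y :: 'a multivector)"

lift_definition scaleR_multivector :: "real \<Rightarrow> 'a multivector \<Rightarrow> 'a multivector"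
  is "\<lambda>c x. free_scalar c * x"
  by (rule ext_rel_mult) (simp_all add: ext_rel_def ideal_zero)

instance
proof
  fix X Y Z :: "'a multivector" and a b :: real
  have eq: "x = y \<Longrightarrow> ext_rel x y" for x y :: "'a free_alg"
    by (simp add: ext_rel_def ideal_zero)
  show "X + Y + Z = X + (Y + Z)" by transfer (simp add: eq add.assoc)
  show "X + Y = Y + X" by transfer (simp add: eq add.commute)
  show "0 + X = X" by transfer (simp add: eq)
  show "- X + X = 0" by transfer (simp add: eq)
  show "X - Y = X + - Y" by (rule minus_multivector_def)
  show "a *\<^sub>R (X + Y) = a *\<^sub>R X + a *\<^sub>R Y" by transfer (simp add: eq algebra_simps)
  show "(a + b) *\<^sub>R X = a *\<^sub>R X + b *\<^sub>R X"
    by transfer (simp add: eq free_scalar_simps algebra_simps)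
  show "a *\<^sub>R b *\<^sub>R X = (a * b) *\<^sub>R X"
    by transfer (simp add: eq free_scalar_simps mult.assoc)
  show "1 *\<^sub>R X = X" by transfer (simp add: eq free_scalar_simps)
qed

end

lift_definition wedge :: "'a::real_vector multivector \<Rightarrow> 'a multivector \<Rightarrow> 'a multivector"
    (infixr \<open>\<and>\<^sub>m\<close> 70)
  is "(*)" by (rule ext_rel_mult)

lift_definition mscalar :: "real \<Rightarrow> 'a::real_vector multivector" is free_scalar .

lift_definition mvector :: "'a::real_vector \<Rightarrow> 'a multivector" is free_gen .

text \<open>The simple multivector \<open>v\<^sub>1 \<and> \<dots> \<and> v\<^sub>k\<close>; for the empty list it is the scalar 1.\<close>

definition blade :: "'a::real_vector list \<Rightarrow> 'a multivector" where
  "blade vs = foldr (\<lambda>v X. mvector v \<and>\<^sub>m X) vs (mscalar 1)"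

definition extended :: "('a::real_vector \<Rightarrow> 'a) \<Rightarrow> 'a multivector \<Rightarrow> 'a multivector" where
  "extended t = (THE T. linear T \<and> (\<forall>\<alpha>. T (mscalar \<alpha>) = mscalar \<alpha>) \<and>
     (\<forall>v. T (mvector v) = mvector (t v)) \<and> (\<forall>X Y. T (X \<and>\<^sub>m Y) = T X \<and>\<^sub>m T Y))"

definition reversion :: "'a::real_vector multivector \<Rightarrow> 'a multivector" where
  "reversion = (THE R. linear R \<and> (\<forall>\<alpha>. R (mscalar \<alpha>) = mscalar \<alpha>) \<and>
     (\<forall>v. R (mvector v) = mvector v) \<and> (\<forall>X Y. R (X \<and>\<^sub>m Y) = R Y \<and>\<^sub>m R X))"


section \<open>Euclidean products of multivectors\<close>

text \<open>
  The condition on blades also covers the scalars, which are the multiples of \<open>blade []\<close>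
  (an empty determinant is 1), and the orthogonality of different grades.
\<close>

definition mdot :: "'a::real_inner multivector \<Rightarrow> 'a multivector \<Rightarrow> real" where
  "mdot = (THE B. bilinear B \<and> (\<forall>vs ws. B (blade vs) (blade ws) =
     (if length vs = length ws
      then Determinant.det (Matrix.mat (length vs) (length ws) (\<lambda>(i, j). inner (vs ! i) (ws ! j)))
      else 0)))"

definition lcontr :: "'a::real_inner multivector \<Rightarrow> 'a multivector \<Rightarrow> 'a multivector" where
  "lcontr X Y = (THE W. \<forall>Z. mdot W Z = mdot Y (reversion X \<and>\<^sub>m Z))"

definition rcontr :: "'a::real_inner multivector \<Rightarrow> 'a multivector \<Rightarrow> 'a multivector" where
  "rcontr X Y = (THE W. \<forall>Z. mdot W Z = mdot X (Z \<and>\<^sub>m reversion Y))"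


section \<open>Metric extensors\<close>

text \<open>
  The determinant of an operator on an n-dimensional space: the factor by which its extended acts
  on the n-fold exterior products of vectors.
\<close>

definition op_det :: "('a::real_vector \<Rightarrow> 'a) \<Rightarrow> real" where
  "op_det t = (THE d. \<forall>vs. length vs = dim (UNIV :: 'a set) \<longrightarrow>
     extended t (blade vs) = d *\<^sub>R blade vs)"

definition metric_extensor :: "('a::real_inner \<Rightarrow> 'a) \<Rightarrow> bool" where
  "metric_extensor g \<longleftrightarrow> linear g \<and> adjoint g = g \<and> op_det g \<noteq> 0"

definition op_eigenvalue :: "('a::real_vector \<Rightarrow> 'a) \<Rightarrow> real \<Rightarrow> bool" where
  "op_eigenvalue t c \<longleftrightarrow> (\<exists>v. v \<noteq> 0 \<and> t v = c *\<^sub>R v)"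

text \<open>
  The multiplicity is the geometric one. Signatures are used for symmetric operators only, for
  which geometric and algebraic multiplicities coincide.
\<close>

definition op_multiplicity :: "('a::real_vector \<Rightarrow> 'a) \<Rightarrow> real \<Rightarrow> nat" where
  "op_multiplicity t c = dim {v. t v = c *\<^sub>R v}"

definition signature :: "('a::real_vector \<Rightarrow> 'a) \<Rightarrow> nat \<times> nat" where
  "signature g =
     ((\<Sum>c | op_eigenvalue g c \<and> c > 0. op_multiplicity g c),
      (\<Sum>c | op_eigenvalue g c \<and> c < 0. op_multiplicity g c))"

definition pseudo_orthogonal :: "('a::real_inner \<Rightarrow> 'a) \<Rightarrow> bool" where
  "pseudo_orthogonal \<eta> \<longleftrightarrow> metric_extensor \<eta> \<and> adjoint \<eta> = Hilbert_Choice.inv \<eta>"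

definition gauge_extensor :: "('a::real_inner \<Rightarrow> 'a) \<Rightarrow> ('a \<Rightarrow> 'a) \<Rightarrow> bool" where
  "gauge_extensor g h \<longleftrightarrow> linear h \<and> bij h \<and>
     (\<exists>\<eta>. pseudo_orthogonal \<eta> \<and> signature \<eta> = signature g \<and> g = adjoint h \<circ> \<eta> \<circ> h)"


section \<open>Products determined by a metric extensor\<close>

definition gdot :: "('a::real_inner \<Rightarrow> 'a) \<Rightarrow> 'a multivector \<Rightarrow> 'a multivector \<Rightarrow> real" where
  "gdot g X Y = mdot (extended g X) Y"

definition glcontr ::
    "('a::real_inner \<Rightarrow> 'a) \<Rightarrow> 'a multivector \<Rightarrow> 'a multivector \<Rightarrow> 'a multivector" where
  "glcontr g X Y = lcontr (extended g X) Y"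

definition grcontr ::
    "('a::real_inner \<Rightarrow> 'a) \<Rightarrow> 'a multivector \<Rightarrow> 'a multivector \<Rightarrow> 'a multivector" where
  "grcontr g X Y = rcontr X (extended g Y)"

definition clifford ::
    "('a::real_inner \<Rightarrow> 'a) \<Rightarrow> 'a multivector \<Rightarrow> 'a multivector \<Rightarrow> 'a multivector" where
  "clifford g = (THE P. bilinear P \<and> (\<forall>X Y Z. P (P X Y) Z = P X (P Y Z)) \<and>
     (\<forall>\<alpha> X. P (mscalar \<alpha>) X = \<alpha> *\<^sub>R X \<and> P X (mscalar \<alpha>) = \<alpha> *\<^sub>R X) \<and>
     (\<forall>v X. P (mvector v) X = glcontr g (mvector v) X + mvector v \<and>\<^sub>m X) \<and>
     (\<forall>v X. P X (mvector v) = grcontr g X (mvector v) + X \<and>\<^sub>m mvector v))"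

end

(*
A universal property of the exterior algebra (a bilinear action of V whose squares vanish extends to
the exterior algebra) yields the extended of an operator, reversion, the contractions, and the scalar
product, whose value on blades is the Laplace expansion of the Gram determinant. By induction along
an orthogonal basis the scalar product is non-degenerate, so that the contracted products are
characterised by their defining equations. Since the extended of the adjoint of h is adjoint to the
extended of h, moving h across the scalar product turns g = h* o eta o h into eta, which settles the
scalar and contracted products.

For the Clifford product, conjugating an eta-Clifford product by h gives a g-Clifford product by the
statements already proved, and a Clifford product is unique because vectors generate. It exists
because left and right Clifford multiplications by vectors commute: the commutant of the right
multiplications is in bijection with the multivectors through evaluation at 1.
*)

theory Submission
  imports Defs
begin

section \<open>The exterior algebra\<close>

lemma ext_rel_refl: "x = y \<Longrightarrow> ext_rel x y"
  by (simp add: ext_rel_def ideal_zero)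

lemma wedge_assoc: "(X \<and>\<^sub>m Y) \<and>\<^sub>m Z = X \<and>\<^sub>m (Y \<and>\<^sub>m Z)"
  by transfer (simp add: ext_rel_refl mult.assoc)

lemma wedge_add_left: "(X + Y) \<and>\<^sub>m Z = (X \<and>\<^sub>m Z) + (Y \<and>\<^sub>m Z)"
  by transfer (simp add: ext_rel_refl algebra_simps)

lemma wedge_add_right: "Z \<and>\<^sub>m (X + Y) = (Z \<and>\<^sub>m X) + (Z \<and>\<^sub>m Y)"
  by transfer (simp add: ext_rel_refl algebra_simps)

text \<open>Inserting a fresh key is the same as adding a monomial, so statements that are additive
  in an element of the free algebra need checking only on multiples of words.\<close>

lemma poly_mapping_add_induct [case_names single add]:
  fixes p :: "'k \<Rightarrow>\<^sub>0 'v::monoid_add"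
  assumes single: "\<And>k c. P (Poly_Mapping.single k c)"
    and add: "\<And>p q. P p \<Longrightarrow> P q \<Longrightarrow> P (p + q)"
  shows "P p"
proof (induction p rule: Poly_Mapping.update_induct)
  case const
  show ?case using single[of undefined 0] by simp
next
  case (update p k c)
  have "Poly_Mapping.update k c p = Poly_Mapping.single k c + p"
    using update(1)
    by (intro poly_mapping_eqI) (auto simp: lookup_update lookup_add lookup_single in_keys_iff when_def)
  then show ?case using add[OF single update(3)] by simp
qed

text \<open>The empty word is neutral for concatenation and real coefficients commute, so scalars
  are central. This makes \<open>wedge\<close> homogeneous in its right factor.\<close>

lemma free_scalar_commute: "free_scalar c * x = x * free_scalar c"
proof (induction x rule: poly_mapping_add_induct)
  case (single k v)
  show ?case by (simp add: free_scalar_def mult_single mult.commute)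
next
  case (add p1 p2)
  then show ?case by (simp add: algebra_simps)
qed

lemma wedge_scaleR_left: "(c *\<^sub>R X) \<and>\<^sub>m Z = c *\<^sub>R (X \<and>\<^sub>m Z)"
  by transfer (simp add: ext_rel_refl mult.assoc)

lemma wedge_scaleR_right: "Z \<and>\<^sub>m (c *\<^sub>R X) = c *\<^sub>R (Z \<and>\<^sub>m X)"
proof transfer
  fix Z X :: "'a free_alg" and c
  have "Z * (free_scalar c * X) = free_scalar c * (Z * X)"
    by (metis free_scalar_commute mult.assoc)
  then show "ext_rel (Z * (free_scalar c * X)) (free_scalar c * (Z * X))"
    by (rule ext_rel_refl)
qed

lemma wedge_mscalar_left [simp]: "mscalar c \<and>\<^sub>m X = c *\<^sub>R X"
  by transfer (simp add: ext_rel_refl)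

lemma wedge_mscalar_right [simp]: "X \<and>\<^sub>m mscalar c = c *\<^sub>R X"
  by transfer (simp add: ext_rel_refl free_scalar_commute)

lemma linear_wedge_left: "linear (\<lambda>X. X \<and>\<^sub>m Z)"
  by (rule linearI) (simp_all add: wedge_add_left wedge_scaleR_left)

lemma linear_wedge_right: "linear (\<lambda>X. Z \<and>\<^sub>m X)"
  by (rule linearI) (simp_all add: wedge_add_right wedge_scaleR_right)

lemma mscalar_eq: "mscalar c = c *\<^sub>R mscalar 1"
  by transfer (simp add: ext_rel_refl free_scalar_simps)

lemma linear_mscalar: "linear mscalar"
  by (rule linearI; transfer) (simp_all add: ext_rel_refl free_scalar_simps)

lemma mvector_add: "mvector (v + w) = mvector v + mvector w"
  by transfer (use rel_add in \<open>auto simp: ext_rel_def algebra_simps\<close>)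

lemma mvector_scaleR: "mvector (c *\<^sub>R v) = c *\<^sub>R mvector v"
  by transfer (use rel_scale in \<open>auto simp: ext_rel_def\<close>)

lemma linear_mvector: "linear mvector"
  by (rule linearI) (simp_all add: mvector_add mvector_scaleR)

lemma mvector_square: "mvector v \<and>\<^sub>m mvector v = 0"
  by transfer (use rel_square in \<open>auto simp: ext_rel_def\<close>)

lemma blade_Nil [simp]: "blade [] = mscalar 1"
  and blade_Cons [simp]: "blade (v # vs) = mvector v \<and>\<^sub>m blade vs"
  by (simp_all add: blade_def)

text \<open>Bridge between the quotient and \<open>blade\<close>: the class of a word is the
  exterior product of its letters.\<close>

lemma abs_multivector_single:
  "abs_multivector (Poly_Mapping.single (MWord vs) c) = c *\<^sub>R blade vs"
proof (induction vs)
  case Nil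
  have "abs_multivector (Poly_Mapping.single (MWord []) c) = mscalar c"
    by (simp add: mscalar.abs_eq free_scalar_def zero_mword_def)
  then show ?case by (simp add: mscalar_eq[of c])
next
  case (Cons v vs)
  have "Poly_Mapping.single (MWord (v # vs)) c
      = free_gen v * Poly_Mapping.single (MWord vs) c"
    by (simp add: free_gen_def mult_single)
  then have "abs_multivector (Poly_Mapping.single (MWord (v # vs)) c)
      = mvector v \<and>\<^sub>m abs_multivector (Poly_Mapping.single (MWord vs) c)"
    by (simp add: mvector.abs_eq wedge.abs_eq)
  then show ?case by (simp add: Cons wedge_scaleR_right)
qed

text \<open>A representative in the free algebra is a sum of multiples of words, so its class is a
  sum of multiples of blades.\<close>

lemma multivector_induct_blade [case_names blade add]:
  assumes blade: "\<And>c vs. P (c *\<^sub>R blade vs)"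
    and add: "\<And>X Y. P X \<Longrightarrow> P Y \<Longrightarrow> P (X + Y)"
  shows "P X"
proof -
  have "P (abs_multivector p)" for p
  proof (induction p rule: poly_mapping_add_induct)
    case (single k c)
    show ?case by (cases k) (simp add: abs_multivector_single blade)
  next
    case (add p q)
    then show ?case unfolding plus_multivector.abs_eq[symmetric] by (rule assms(2))
  qed
  then show ?thesis by (metis Quotient3_abs_rep Quotient3_multivector)
qed

lemma multivector_induct [case_names scalar vector add]:
  assumes scalar: "\<And>c. P (mscalar c)"
    and vector: "\<And>v X. P X \<Longrightarrow> P (mvector v \<and>\<^sub>m X)"
    and add: "\<And>X Y. P X \<Longrightarrow> P Y \<Longrightarrow> P (X + Y)"
  shows "P X"
proof (induction X rule: multivector_induct_blade)
  case (blade c vs)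
  show ?case
  proof (induction vs)
    case Nil
    show ?case unfolding blade_Nil mscalar_eq[of c, symmetric] by (rule scalar)
  next
    case (Cons v vs)
    then show ?case using vector[of "c *\<^sub>R blade vs" v] by (simp add: wedge_scaleR_right)
  qed
qed (rule add)

section \<open>The universal property\<close>

fun word_act :: "('a \<Rightarrow> 'b \<Rightarrow> 'b) \<Rightarrow> 'a mword \<Rightarrow> 'b \<Rightarrow> 'b" where
  "word_act \<phi> (MWord vs) = foldr \<phi> vs"

text \<open>The linear extension of \<open>word_act\<close>, which turns the target space into a
  module over the free algebra.\<close>

definition free_act :: "('a \<Rightarrow> 'b \<Rightarrow> 'b) \<Rightarrow> 'a free_alg \<Rightarrow> 'b \<Rightarrow> 'b::real_vector" where
  "free_act \<phi> p x = (\<Sum>w\<in>Poly_Mapping.keys p. Poly_Mapping.lookup p w *\<^sub>R word_act \<phi> w x)"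

lemma free_act_superset:
  assumes "finite A" "Poly_Mapping.keys p \<subseteq> A"
  shows "free_act \<phi> p x = (\<Sum>w\<in>A. Poly_Mapping.lookup p w *\<^sub>R word_act \<phi> w x)"
  unfolding free_act_def
  using assms by (intro sum.mono_neutral_left) (auto simp: in_keys_iff)

lemma free_act_add: "free_act \<phi> (p + q) x = free_act \<phi> p x + free_act \<phi> q x"
proof -
  let ?A = "Poly_Mapping.keys p \<union> Poly_Mapping.keys q"
  have "Poly_Mapping.keys (p + q) \<subseteq> ?A" by (rule Poly_Mapping.keys_add)
  then show ?thesis
    by (simp add: free_act_superset[of ?A] lookup_add scaleR_add_left sum.distrib)
qed

lemma free_act_single: "free_act \<phi> (Poly_Mapping.single w c) x = c *\<^sub>R word_act \<phi> w x"
  by (simp add: free_act_superset[of "{w}"])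

lemma free_act_diff: "free_act \<phi> (p - q) x = free_act \<phi> p x - free_act \<phi> q x"
  using free_act_add[of \<phi> "p - q" q x] by (simp add: algebra_simps)

text \<open>The two assumptions say that the generators of \<open>ext_ideal\<close> act as zero, so
  the locale describes modules over the exterior algebra by the action of vectors alone. Every map
  out of the algebra is built from such an action below.\<close>

locale exterior_module =
  fixes \<phi> :: "'a::real_vector \<Rightarrow> 'b::real_vector \<Rightarrow> 'b"
  assumes bilinear: "bilinear \<phi>"
    and square_zero: "\<phi> v (\<phi> v x) = 0"
begin

lemma linear_word_act: "linear (word_act \<phi> w)"
proof (cases w)
  case (MWord vs)
  have "linear (foldr \<phi> vs)"
  proof (induction vs)
    case Nil
    show ?case by (simp add: linear_id[unfolded id_def] id_def)
  next
    case (Cons v vs)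
    have "linear (\<phi> v)" using bilinear by (simp add: bilinear_def)
    from linear_compose[OF Cons this] show ?case by (simp add: comp_def)
  qed
  then show ?thesis by (simp add: MWord)
qed

lemma linear_free_act: "linear (free_act \<phi> p)"
  unfolding free_act_def[abs_def]
  by (intro linear_compose_sum ballI linear_compose_scale_right linear_word_act)

lemma word_act_plus: "word_act \<phi> (w + u) x = word_act \<phi> w (word_act \<phi> u x)"
  by (cases w; cases u) simp

lemma free_act_mult: "free_act \<phi> (p * q) x = free_act \<phi> p (free_act \<phi> q x)"
proof (induction p arbitrary: x rule: poly_mapping_add_induct)
  case (single w c)
  show ?case
  proof (induction q rule: poly_mapping_add_induct)
    case (single u d)
    show ?case
      by (simp add: mult_single free_act_single word_act_plus linear_scale[OF linear_word_act])
  next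
    case (add q1 q2)
    then show ?case by (simp add: distrib_left free_act_add linear_add[OF linear_free_act])
  qed
next
  case (add p1 p2)
  then show ?case by (simp add: distrib_right free_act_add)
qed

text \<open>Bilinearity handles the linear relations and \<open>square_zero\<close> the squares;
  \<open>free_act_mult\<close> carries the vanishing through products on both sides.\<close>

lemma free_act_ideal:
  assumes "p \<in> ext_ideal"
  shows "free_act \<phi> p x = 0"
  using assms
proof (induction p arbitrary: x rule: ext_ideal.induct)
  case (rel_add v w)
  show ?case
    by (simp add: free_act_diff free_gen_def free_act_single bilinear_ladd[OF bilinear])
next
  case (rel_scale c v)
  show ?case
    by (simp add: free_act_diff free_act_mult free_gen_def free_scalar_def free_act_single
        bilinear_lmul[OF bilinear] zero_mword_def)
next
  case (rel_square v)
  show ?case by (simp add: free_act_mult free_gen_def free_act_single square_zero)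
next
  case ideal_zero
  show ?case by (simp add: free_act_def)
next
  case (ideal_add p q)
  then show ?case by (simp add: free_act_add)
next
  case (ideal_mult p a b)
  then show ?case by (simp add: free_act_mult linear_0[OF linear_free_act])
qed

definition act :: "'a multivector \<Rightarrow> 'b \<Rightarrow> 'b" where
  "act X x = free_act \<phi> (rep_multivector X) x"

text \<open>Two representatives differ by an element of the ideal, which acts as zero; hence the one
  chosen by \<open>rep_multivector\<close> does not matter.\<close>

lemma act_abs: "act (abs_multivector p) x = free_act \<phi> p x"
proof -
  have "ext_rel (rep_multivector (abs_multivector p)) p"
    by (rule Quotient3_rep_abs[OF Quotient3_multivector ext_rel_refl[OF refl]])
  then show ?thesis
    using free_act_ideal free_act_diff unfolding act_def ext_rel_def
    by (metis eq_iff_diff_eq_0)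
qed

lemma act_add: "act (X + Y) x = act X x + act Y x"
proof -
  obtain p q where "X = abs_multivector p" "Y = abs_multivector q"
    by (metis Quotient3_abs_rep Quotient3_multivector)
  then show ?thesis by (simp add: plus_multivector.abs_eq act_abs free_act_add)
qed

lemma act_wedge: "act (X \<and>\<^sub>m Y) x = act X (act Y x)"
proof -
  obtain p q where "X = abs_multivector p" "Y = abs_multivector q"
    by (metis Quotient3_abs_rep Quotient3_multivector)
  then show ?thesis by (simp add: wedge.abs_eq act_abs free_act_mult)
qed

lemma act_mscalar: "act (mscalar c) x = c *\<^sub>R x"
  by (simp add: mscalar.abs_eq act_abs free_scalar_def free_act_single zero_mword_def)

lemma act_mvector: "act (mvector v) x = \<phi> v x"
  by (simp add: mvector.abs_eq act_abs free_gen_def free_act_single)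

lemma bilinear_act: "bilinear act"
proof -
  have "act (c *\<^sub>R X) x = c *\<^sub>R act X x" for c X x
    using act_wedge[of "mscalar c" X x] by (simp add: act_mscalar)
  then show ?thesis
    using linear_free_act by (auto simp: bilinear_def act_def[abs_def] act_add[unfolded act_def] intro: linearI)
qed

end

text \<open>The uniqueness half of the universal property: 1 and left multiplication by vectors
  generate everything.\<close>

lemma linear_multivector_eqI:
  assumes "linear F" "linear G" "F (mscalar 1) = G (mscalar 1)"
    and "\<And>v X. F X = G X \<Longrightarrow> F (mvector v \<and>\<^sub>m X) = G (mvector v \<and>\<^sub>m X)"
  shows "F X = G X"
proof (induction X rule: multivector_induct)
  case (scalar c)
  show ?case
    using assms(3) by (simp add: mscalar_eq[of c] linear_scale[OF assms(1)] linear_scale[OF assms(2)])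
next
  case (vector v X)
  then show ?case by (rule assms(4))
next
  case (add X Y)
  then show ?case by (simp add: linear_add[OF assms(1)] linear_add[OF assms(2)])
qed

lemma bilinear_multivector_eqI:
  assumes "bilinear F" "bilinear G"
    and "\<And>vs ws. F (blade vs) (blade ws) = G (blade vs) (blade ws)"
  shows "F = G"
proof (intro ext)
  fix X Y
  show "F X Y = G X Y"
  proof (induction X rule: multivector_induct_blade)
    case (blade c vs)
    show ?case
    proof (induction Y rule: multivector_induct_blade)
      case (blade d ws)
      show ?case
        using assms(3)[of vs ws]
        by (simp add: bilinear_lmul[OF assms(1)] bilinear_lmul[OF assms(2)]
            bilinear_rmul[OF assms(1)] bilinear_rmul[OF assms(2)])
    qed (simp add: bilinear_radd[OF assms(1)] bilinear_radd[OF assms(2)])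
  qed (simp add: bilinear_ladd[OF assms(1)] bilinear_ladd[OF assms(2)])
qed

section \<open>The extended of an operator, and reversion\<close>

lemma extended_unique:
  assumes "linear T" "\<forall>\<alpha>. T (mscalar \<alpha>) = mscalar \<alpha>" "\<forall>v. T (mvector v) = mvector (t v)"
    "\<forall>X Y. T (X \<and>\<^sub>m Y) = T X \<and>\<^sub>m T Y"
  shows "extended t = T"
  unfolding extended_def
proof (rule the_equality)
  show "linear T \<and> (\<forall>\<alpha>. T (mscalar \<alpha>) = mscalar \<alpha>) \<and>
     (\<forall>v. T (mvector v) = mvector (t v)) \<and> (\<forall>X Y. T (X \<and>\<^sub>m Y) = T X \<and>\<^sub>m T Y)"
    using assms by blast
next
  fix S
  assume S: "linear S \<and> (\<forall>\<alpha>. S (mscalar \<alpha>) = mscalar \<alpha>) \<and>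
     (\<forall>v. S (mvector v) = mvector (t v)) \<and> (\<forall>X Y. S (X \<and>\<^sub>m Y) = S X \<and>\<^sub>m S Y)"
  show "S = T"
    by (rule ext, rule linear_multivector_eqI) (use S assms in auto)
qed

lemma reversion_unique:
  assumes "linear R" "\<forall>\<alpha>. R (mscalar \<alpha>) = mscalar \<alpha>" "\<forall>v. R (mvector v) = mvector v"
    "\<forall>X Y. R (X \<and>\<^sub>m Y) = R Y \<and>\<^sub>m R X"
  shows "reversion = R"
  unfolding reversion_def
proof (rule the_equality)
  show "linear R \<and> (\<forall>\<alpha>. R (mscalar \<alpha>) = mscalar \<alpha>) \<and>
     (\<forall>v. R (mvector v) = mvector v) \<and> (\<forall>X Y. R (X \<and>\<^sub>m Y) = R Y \<and>\<^sub>m R X)"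
    using assms by blast
next
  fix S :: "'a multivector \<Rightarrow> 'a multivector"
  assume S: "linear S \<and> (\<forall>\<alpha>. S (mscalar \<alpha>) = mscalar \<alpha>) \<and>
     (\<forall>v. S (mvector v) = mvector v) \<and> (\<forall>X Y. S (X \<and>\<^sub>m Y) = S Y \<and>\<^sub>m S X)"
  show "S = R"
    by (rule ext, rule linear_multivector_eqI) (use S assms in auto)
qed

lemma extended_exists:
  fixes t :: "'a::real_vector \<Rightarrow> 'a"
  assumes t: "linear t"
  obtains T where "linear T" "\<forall>\<alpha>. T (mscalar \<alpha>) = mscalar \<alpha>"
    "\<forall>v. T (mvector v) = mvector (t v)" "\<forall>X Y. T (X \<and>\<^sub>m Y) = T X \<and>\<^sub>m T Y"
proof -
  interpret exterior_module "\<lambda>v X. mvector (t v) \<and>\<^sub>m X"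
  proof
    show "bilinear (\<lambda>v X. mvector (t v) \<and>\<^sub>m X)"
      by (auto simp: bilinear_def linear_iff linear_add[OF t] linear_scale[OF t] mvector_add
          mvector_scaleR wedge_add_left wedge_add_right wedge_scaleR_left wedge_scaleR_right)
    show "mvector (t v) \<and>\<^sub>m mvector (t v) \<and>\<^sub>m X = 0" for v X
      using wedge_mscalar_left[of 0]
      by (simp add: wedge_assoc[symmetric] mvector_square linear_0[OF linear_wedge_left])
  qed
  \<comment> \<open>The vector \<open>v\<close> acts as multiplication by \<open>t v\<close>, so
    applying the action of a product of vectors to 1 multiplies their images under
    \<open>t\<close>.\<close>
  let ?T = "\<lambda>X. act X (mscalar 1)"
  have lin: "linear ?T" using bilinear_act by (simp add: bilinear_def)
  have "?T (X \<and>\<^sub>m Y) = ?T X \<and>\<^sub>m ?T Y" for X Y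
  proof (induction X rule: multivector_induct)
    case (scalar c)
    then show ?case by (simp add: act_mscalar linear_scale[OF lin] wedge_scaleR_left)
  next
    case (vector v X)
    then show ?case by (simp add: wedge_assoc) (simp add: act_wedge act_mvector wedge_assoc)
  next
    case (add X Z)
    then show ?case by (simp add: wedge_add_left act_add)
  qed
  moreover have "?T (mscalar \<alpha>) = mscalar \<alpha>" for \<alpha>
    by (simp add: act_mscalar mscalar_eq[symmetric])
  ultimately show ?thesis
    using that[of ?T] lin by (simp add: act_mvector)
qed

lemma
  assumes "linear t"
  shows linear_extended: "linear (extended t)"
    and extended_mscalar: "extended t (mscalar c) = mscalar c"
    and extended_mvector: "extended t (mvector v) = mvector (t v)"
    and extended_wedge: "extended t (X \<and>\<^sub>m Y) = extended t X \<and>\<^sub>m extended t Y"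
proof -
  obtain T where T: "linear T" "\<forall>\<alpha>. T (mscalar \<alpha>) = mscalar \<alpha>"
    "\<forall>v. T (mvector v) = mvector (t v)" "\<forall>X Y. T (X \<and>\<^sub>m Y) = T X \<and>\<^sub>m T Y"
    using extended_exists[OF assms] .
  have [simp]: "extended t = T" using T by (rule extended_unique)
  show "linear (extended t)" "extended t (mscalar c) = mscalar c"
    "extended t (mvector v) = mvector (t v)" "extended t (X \<and>\<^sub>m Y) = extended t X \<and>\<^sub>m extended t Y"
    using T by simp_all
qed

lemma reversion_exists:
  obtains R :: "'a::real_vector multivector \<Rightarrow> 'a multivector"
  where "linear R" "\<forall>\<alpha>. R (mscalar \<alpha>) = mscalar \<alpha>"
    "\<forall>v. R (mvector v) = mvector v" "\<forall>X Y. R (X \<and>\<^sub>m Y) = R Y \<and>\<^sub>m R X"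
proof -
  \<comment> \<open>Multiplying on the right puts the vector that acts last at the end, which
    reverses the order of the factors.\<close>
  interpret exterior_module "\<lambda>v X :: 'a multivector. X \<and>\<^sub>m mvector v"
  proof
    show "bilinear (\<lambda>v X :: 'a multivector. X \<and>\<^sub>m mvector v)"
      by (auto simp: bilinear_def linear_iff mvector_add
          mvector_scaleR wedge_add_left wedge_add_right wedge_scaleR_left wedge_scaleR_right)
    show "(X \<and>\<^sub>m mvector v) \<and>\<^sub>m mvector v = 0" for v and X :: "'a multivector"
      by (simp add: wedge_assoc mvector_square linear_0[OF linear_wedge_right])
  qed
  let ?R = "\<lambda>X. act X (mscalar 1)"
  have lin: "linear ?R" using bilinear_act by (simp add: bilinear_def)
  have "?R (X \<and>\<^sub>m Y) = ?R Y \<and>\<^sub>m ?R X" for X Y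
  proof (induction X rule: multivector_induct)
    case (scalar c)
    then show ?case by (simp add: act_mscalar linear_scale[OF lin] wedge_scaleR_right)
  next
    case (vector v X)
    then show ?case by (simp add: wedge_assoc) (simp add: act_wedge act_mvector wedge_assoc)
  next
    case (add X Z)
    then show ?case by (simp add: wedge_add_left wedge_add_right act_add)
  qed
  moreover have "?R (mscalar \<alpha>) = mscalar \<alpha>" for \<alpha>
    by (simp add: act_mscalar mscalar_eq[symmetric])
  ultimately show ?thesis
    using that[of ?R] lin by (simp add: act_mvector)
qed

lemma
  shows linear_reversion: "linear (reversion :: 'a::real_vector multivector \<Rightarrow> 'a multivector)"
    and reversion_mscalar [simp]: "reversion (mscalar c) = (mscalar c :: 'a multivector)"
    and reversion_mvector [simp]: "reversion (mvector v) = mvector (v :: 'a)"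
    and reversion_wedge: "reversion (X \<and>\<^sub>m Y :: 'a multivector) = reversion Y \<and>\<^sub>m reversion X"
proof -
  obtain R :: "'a multivector \<Rightarrow> 'a multivector" where R: "linear R" "\<forall>\<alpha>. R (mscalar \<alpha>) = mscalar \<alpha>"
    "\<forall>v. R (mvector v) = mvector v" "\<forall>X Y. R (X \<and>\<^sub>m Y) = R Y \<and>\<^sub>m R X"
    using reversion_exists .
  have [simp]: "reversion = R" using R by (rule reversion_unique)
  show "linear (reversion :: 'a multivector \<Rightarrow> 'a multivector)"
    "reversion (mscalar c) = (mscalar c :: 'a multivector)"
    "reversion (mvector v) = mvector (v :: 'a)"
    "reversion (X \<and>\<^sub>m Y :: 'a multivector) = reversion Y \<and>\<^sub>m reversion X"
    using R by simp_all
qed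

lemma reversion_reversion [simp]: "reversion (reversion X) = X"
  by (rule linear_multivector_eqI[of "\<lambda>X. reversion (reversion X)" "\<lambda>X. X"])
    (simp_all add: linear_compose[OF linear_reversion linear_reversion, unfolded comp_def]
      linear_ident reversion_wedge)

text \<open>Functoriality: the composite of the two extended maps has the properties that
  characterise the extended of \<open>s \<circ> t\<close>.\<close>

lemma extended_comp:
  assumes "linear s" "linear t"
  shows "extended (s \<circ> t) X = extended s (extended t X)"
proof -
  have "extended (s \<circ> t) = extended s \<circ> extended t"
    by (rule extended_unique)
      (simp_all add: assms linear_extended linear_compose extended_mscalar extended_mvector extended_wedge)
  then show ?thesis by simp
qed

lemma extended_id: "extended id X = (X :: 'a::real_vector multivector)"
proof -
  have "extended (id :: 'a \<Rightarrow> 'a) = id"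
    by (rule extended_unique) (simp_all add: linear_id)
  then show ?thesis by simp
qed

lemma extended_reversion:
  assumes "linear t"
  shows "extended t (reversion X) = reversion (extended t X)"
  by (rule linear_multivector_eqI)
    (simp_all add: assms linear_extended linear_compose[OF linear_reversion, unfolded comp_def]
      linear_compose[OF _ linear_reversion, unfolded comp_def]
      extended_mscalar extended_mvector extended_wedge reversion_wedge)

lemma extended_blade: "linear t \<Longrightarrow> extended t (blade vs) = blade (map t vs)"
  by (induction vs) (simp_all add: extended_mscalar extended_mvector extended_wedge)

section \<open>Contraction by a vector\<close>

text \<open>The antiderivation has to know its argument as well as its value so far, whence the action
  on pairs; the first component of the pair is the argument itself.\<close>

definition icontr :: "'a::real_inner \<Rightarrow> 'a multivector \<Rightarrow> 'a multivector" where
  "icontr a X = snd (exterior_module.act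
     (\<lambda>v (Y, D). (mvector v \<and>\<^sub>m Y, inner a v *\<^sub>R Y - mvector v \<and>\<^sub>m D)) X (mscalar 1, 0))"

lemma
  fixes a :: "'a::real_inner"
  shows linear_icontr: "linear (icontr a)"
    and icontr_mscalar [simp]: "icontr a (mscalar c) = 0"
    and icontr_wedge: "icontr a (mvector v \<and>\<^sub>m X) = inner a v *\<^sub>R X - mvector v \<and>\<^sub>m icontr a X"
proof -
  define \<phi> :: "'a \<Rightarrow> 'a multivector \<times> 'a multivector \<Rightarrow> _"
    where "\<phi> = (\<lambda>v (Y, D). (mvector v \<and>\<^sub>m Y, inner a v *\<^sub>R Y - mvector v \<and>\<^sub>m D))"
  have fst_\<phi>: "fst (\<phi> v y) = mvector v \<and>\<^sub>m fst y"
    and snd_\<phi>: "snd (\<phi> v y) = inner a v *\<^sub>R fst y - mvector v \<and>\<^sub>m snd y" for v y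
    by (simp_all add: \<phi>_def split: prod.split)
  interpret exterior_module \<phi>
  proof
    show "bilinear \<phi>"
      by (auto simp: bilinear_def linear_iff \<phi>_def mvector_add inner_add_right
          mvector_scaleR wedge_add_left wedge_add_right wedge_scaleR_left wedge_scaleR_right
          algebra_simps)
    \<comment> \<open>In the second component the two terms with the factor \<open>inner a v\<close>
      cancel; all that remains contains the square of \<open>mvector v\<close>.\<close>
    show "\<phi> v (\<phi> v x) = 0" for v x
      by (simp add: \<phi>_def split: prod.split)
        (simp add: wedge_assoc[symmetric] mvector_square linear_0[OF linear_wedge_left]
          linear_diff[OF linear_wedge_right] wedge_scaleR_right zero_prod_def)
  qed
  let ?x = "(mscalar 1, 0) :: 'a multivector \<times> 'a multivector"
  have i: "icontr a X = snd (act X ?x)" for X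
    unfolding icontr_def \<phi>_def ..
  have lin: "linear (\<lambda>X. act X ?x)" using bilinear_act by (simp add: bilinear_def)
  \<comment> \<open>The first component merely rebuilds the multivector, which supplies the
    undifferentiated factor in the antiderivation rule.\<close>
  have fst_act: "fst (act X ?x) = X" for X
    by (rule linear_multivector_eqI[of "\<lambda>X. fst (act X ?x)" "\<lambda>X. X"])
      (simp_all add: linear_iff act_add act_mscalar act_wedge act_mvector linear_scale[OF lin] fst_\<phi>)
  show "linear (icontr a)"
    by (simp add: linear_iff i act_add linear_scale[OF lin])
  show "icontr a (mscalar c) = 0"
    by (simp add: i act_mscalar)
  show "icontr a (mvector v \<and>\<^sub>m X) = inner a v *\<^sub>R X - mvector v \<and>\<^sub>m icontr a X"
    by (simp add: i act_wedge act_mvector snd_\<phi> fst_act)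
qed

text \<open>On a product with a leading vector the two mixed terms cancel, and the remaining one
  vanishes by induction.\<close>

lemma icontr_icontr: "icontr a (icontr a X) = 0"
  by (rule linear_multivector_eqI[of "\<lambda>X. icontr a (icontr a X)" "\<lambda>X. 0"])
    (simp_all add: linear_compose[OF linear_icontr linear_icontr, unfolded comp_def]
      linear_zero icontr_wedge linear_diff[OF linear_icontr] linear_scale[OF linear_icontr]
      linear_0[OF linear_icontr] linear_0[OF linear_wedge_right])

lemma bilinear_icontr: "bilinear icontr"
proof -
  have "icontr (a + b) X = icontr a X + icontr b X" for a b :: 'a and X
    by (rule linear_multivector_eqI)
      (simp_all add: linear_icontr linear_compose_add icontr_wedge inner_add_left wedge_add_right algebra_simps)
  moreover have "icontr (c *\<^sub>R a) X = c *\<^sub>R icontr a X" for c and a :: 'a and X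
    by (rule linear_multivector_eqI)
      (simp_all add: linear_icontr linear_compose_scale_right icontr_wedge wedge_scaleR_right algebra_simps)
  ultimately show ?thesis
    by (simp add: bilinear_def linear_icontr) (simp add: linear_iff)
qed

text \<open>Since contractions by vectors also square to zero, the universal property extends them
  to contraction by an arbitrary multivector, \<open>icontr.act\<close>.\<close>

interpretation icontr: exterior_module icontr
  by standard (simp_all add: bilinear_icontr icontr_icontr)

text \<open>The contraction passes each factor with a change of sign before it meets the next one.
  This has the shape of a Laplace expansion.\<close>

lemma icontr_blade:
  "icontr a (blade ws) =
    (\<Sum>j<length ws. ((- 1) ^ j * inner a (ws ! j)) *\<^sub>R blade (take j ws @ drop (Suc j) ws))"
proof (induction ws)
  case Nil
  show ?case by simp
next
  case (Cons w ws)
  have "icontr a (blade (w # ws)) = inner a w *\<^sub>R blade ws - mvector w \<and>\<^sub>m icontr a (blade ws)"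
    by (simp add: icontr_wedge)
  also have "mvector w \<and>\<^sub>m icontr a (blade ws) =
    (\<Sum>j<length ws. ((- 1) ^ j * inner a (ws ! j)) *\<^sub>R (mvector w \<and>\<^sub>m blade (take j ws @ drop (Suc j) ws)))"
    unfolding Cons by (simp add: linear_sum[OF linear_wedge_right] wedge_scaleR_right)
  finally show ?case
    by (simp add: sum.lessThan_Suc_shift sum_negf[symmetric] del: sum.lessThan_Suc)
qed

section \<open>The euclidean scalar product\<close>

text \<open>Vectors act on the reals as zero, so only the part of grade 0 survives.\<close>

definition scalar_part :: "'a::real_vector multivector \<Rightarrow> real" where
  "scalar_part X = exterior_module.act (\<lambda>v x. 0) X 1"

lemma
  shows linear_scalar_part: "linear (scalar_part :: 'a::real_vector multivector \<Rightarrow> real)"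
    and scalar_part_mscalar [simp]: "scalar_part (mscalar c :: 'a multivector) = c"
    and scalar_part_wedge [simp]: "scalar_part (mvector (v :: 'a) \<and>\<^sub>m X) = 0"
proof -
  interpret exterior_module "\<lambda>(v :: 'a) x :: real. 0"
    by standard (simp_all add: bilinear_def linear_zero)
  show "linear (scalar_part :: 'a multivector \<Rightarrow> real)"
    using bilinear_act by (simp add: bilinear_def scalar_part_def[abs_def])
  show "scalar_part (mscalar c :: 'a multivector) = c" "scalar_part (mvector (v :: 'a) \<and>\<^sub>m X) = 0"
    by (simp_all add: scalar_part_def act_mscalar act_wedge act_mvector)
qed

text \<open>With the reversion, the leading vector of \<open>X\<close> is contracted into
  \<open>Y\<close> first; see \<open>contr_form_vector\<close>.\<close>

definition contr_form :: "'a::real_inner multivector \<Rightarrow> 'a multivector \<Rightarrow> real" where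
  "contr_form X Y = scalar_part (icontr.act (reversion X) Y)"

lemma bilinear_contr_form: "bilinear contr_form"
  unfolding bilinear_def contr_form_def
  using icontr.bilinear_act[unfolded bilinear_def]
    linear_compose[OF linear_reversion, unfolded comp_def]
    linear_compose[OF _ linear_scalar_part, unfolded comp_def]
  by blast

lemma contr_form_vector: "contr_form (mvector v \<and>\<^sub>m X) Y = contr_form X (icontr v Y)"
  by (simp add: contr_form_def reversion_wedge icontr.act_wedge icontr.act_mvector)

lemma contr_form_mscalar: "contr_form (mscalar c) Y = c * scalar_part Y"
  by (simp add: contr_form_def icontr.act_mscalar linear_scale[OF linear_scalar_part])

text \<open>Contracting with the leading vector expands the Gram determinant along its first row.
  Each contraction shortens both lists by one, so unequal lengths give 0.\<close>

lemma contr_form_blade: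
  "contr_form (blade vs) (blade ws) =
     (if length vs = length ws
      then Determinant.det (Matrix.mat (length vs) (length ws) (\<lambda>(i, j). inner (vs ! i) (ws ! j)))
      else 0)"
proof (induction vs arbitrary: ws)
  case Nil
  show ?case
    by (cases ws) (simp_all add: contr_form_mscalar det_dim_zero[of "Matrix.mat 0 0 f" for f])
next
  case (Cons v vs)
  let ?n = "length vs"
  define A where "A = Matrix.mat (Suc ?n) (Suc ?n) (\<lambda>(i, j). inner ((v # vs) ! i) (ws ! j))"
  let ?del = "\<lambda>j. take j ws @ drop (Suc j) ws"
  have lin: "linear (contr_form (blade vs))" by (simp add: bilinear_contr_form[unfolded bilinear_def])
  have expand: "contr_form (blade (v # vs)) (blade ws) =
      (\<Sum>j<length ws. (- 1) ^ j * inner v (ws ! j) * contr_form (blade vs) (blade (?del j)))"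
    by (simp add: contr_form_vector icontr_blade linear_sum[OF lin] linear_scale[OF lin])
  show ?case
  proof (cases "length ws = Suc ?n")
    case False
    have "contr_form (blade vs) (blade (?del j)) = 0" if "j < length ws" for j
      using False that by (simp add: Cons)
    then show ?thesis using False unfolding expand by simp
  next
    case True
    have A: "A \<in> carrier_mat (Suc ?n) (Suc ?n)" by (simp add: A_def)
    have "(- 1) ^ j * inner v (ws ! j) * contr_form (blade vs) (blade (?del j))
        = A $$ (0, j) * cofactor A 0 j" if j: "j < Suc ?n" for j
    proof -
      \<comment> \<open>Deleting row 0 and column \<open>j\<close> leaves the Gram matrix of the
        shortened lists, so the induction hypothesis evaluates the minor.\<close>
      have "mat_delete A 0 j = Matrix.mat ?n ?n (\<lambda>(i, k). inner (vs ! i) (?del j ! k))"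
        using True j
        by (intro eq_matI) (auto simp: mat_delete_def A_def nth_append)
      moreover have "length (?del j) = ?n" using True j by simp
      ultimately have "contr_form (blade vs) (blade (?del j)) = Determinant.det (mat_delete A 0 j)"
        by (simp add: Cons)
      then show ?thesis using j by (simp add: cofactor_def A_def)
    qed
    then have "contr_form (blade (v # vs)) (blade ws) = (\<Sum>j<Suc ?n. A $$ (0, j) * cofactor A 0 j)"
      unfolding expand True by (intro sum.cong) auto
    also have "\<dots> = Determinant.det A"
      by (rule laplace_expansion_row[OF A, symmetric]) simp
    finally show ?thesis using True by (simp add: A_def)
  qed
qed

text \<open>Resolves the definite description: \<open>contr_form\<close> has the prescribed values,
  and values on blades determine a bilinear form.\<close>

lemma mdot_eq_contr_form: "mdot = contr_form"
  unfolding mdot_def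
proof (rule the_equality)
  fix B :: "'a multivector \<Rightarrow> 'a multivector \<Rightarrow> real"
  assume "bilinear B \<and> (\<forall>vs ws. B (blade vs) (blade ws) =
     (if length vs = length ws
      then Determinant.det (Matrix.mat (length vs) (length ws) (\<lambda>(i, j). inner (vs ! i) (ws ! j)))
      else 0))"
  then show "B = contr_form"
    by (intro bilinear_multivector_eqI[OF _ bilinear_contr_form]) (simp_all add: contr_form_blade)
qed (simp add: bilinear_contr_form contr_form_blade)

lemmas bilinear_mdot = bilinear_contr_form[folded mdot_eq_contr_form]
  and mdot_blade = contr_form_blade[folded mdot_eq_contr_form]
  and mdot_mscalar = contr_form_mscalar[folded mdot_eq_contr_form]
  and mdot_eq = contr_form_def[folded mdot_eq_contr_form]

lemma linear_mdot_left: "linear (\<lambda>X. mdot X Y)" and linear_mdot_right: "linear (mdot X)"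
  by (simp_all add: bilinear_mdot[unfolded bilinear_def])

text \<open>Exchanging the arguments transposes the Gram matrix.\<close>

lemma mdot_commute: "mdot X Y = mdot Y X"
proof -
  have "mdot = (\<lambda>X Y. mdot Y X)"
  proof (rule bilinear_multivector_eqI[OF bilinear_mdot])
    show "bilinear (\<lambda>X Y. mdot Y X)"
      by (simp add: bilinear_def linear_mdot_left linear_mdot_right)
    fix vs ws :: "'b list"
    show "mdot (blade vs) (blade ws) = mdot (blade ws) (blade vs)"
    proof (cases "length vs = length ws")
      case True
      let ?M = "\<lambda>vs ws. Matrix.mat (length vs) (length ws) (\<lambda>(i, j). inner (vs ! i) (ws ! j :: 'b))"
      have "?M ws vs = transpose_mat (?M vs ws)"
        by (intro eq_matI) (auto simp: inner_commute)
      then show ?thesis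
        using True det_transpose[of "?M vs ws" "length vs"] by (simp add: mdot_blade)
    qed (simp add: mdot_blade)
  qed
  then show ?thesis by metis
qed

text \<open>\<open>icontr.act\<close> turns wedge into composition, so the factor \<open>X\<close>
  can be peeled off inside \<open>mdot_eq\<close>. The result is the defining equation of
  \<open>lcontr\<close>.\<close>

lemma mdot_contract: "mdot (icontr.act X Y) Z = mdot Y (reversion X \<and>\<^sub>m Z)"
proof -
  have "mdot Y (reversion X \<and>\<^sub>m Z) = mdot (reversion X \<and>\<^sub>m Z) Y" by (rule mdot_commute)
  also have "\<dots> = mdot Z (icontr.act X Y)"
    by (simp add: mdot_eq reversion_wedge icontr.act_wedge)
  finally show ?thesis by (simp add: mdot_commute)
qed

lemma mdot_icontr: "mdot (icontr v Y) Z = mdot Y (mvector v \<and>\<^sub>m Z)"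
  using mdot_contract[of "mvector v" Y Z] by (simp add: icontr.act_mvector)

text \<open>Polarisation of the vanishing square of \<open>v + w\<close>. The trailing factor
  \<open>X\<close> suits products nested to the right.\<close>

lemma mvector_anticommute: "mvector v \<and>\<^sub>m mvector w \<and>\<^sub>m X = - (mvector w \<and>\<^sub>m mvector v \<and>\<^sub>m X)"
proof -
  have "mvector (v + w) \<and>\<^sub>m mvector (v + w) = 0" by (rule mvector_square)
  then have "(mvector v \<and>\<^sub>m mvector w) + (mvector w \<and>\<^sub>m mvector v) = 0"
    by (simp add: mvector_add wedge_add_left wedge_add_right mvector_square add.commute)
  then have "((mvector v \<and>\<^sub>m mvector w) + (mvector w \<and>\<^sub>m mvector v)) \<and>\<^sub>m X = 0"
    by (simp add: linear_0[OF linear_wedge_left])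
  then show ?thesis by (simp add: wedge_add_left wedge_assoc eq_neg_iff_add_eq_0)
qed

section \<open>Non-degeneracy of the scalar product\<close>

text \<open>The multivectors that involve only vectors of the list \<open>es\<close>, with the first vector
  split off; contraction by it, for an orthogonal list, recovers the second component.\<close>

primrec ext_gen :: "'a::real_vector list \<Rightarrow> 'a multivector set" where
  "ext_gen [] = range mscalar"
| "ext_gen (e # es) = {A + mvector e \<and>\<^sub>m B |A B. A \<in> ext_gen es \<and> B \<in> ext_gen es}"

lemma subspace_ext_gen: "subspace (ext_gen es)"
proof (induction es)
  case Nil
  show ?case
    unfolding ext_gen.simps by (rule linear_subspace_image[OF linear_mscalar subspace_UNIV])
next
  case (Cons e es)
  have "ext_gen (e # es) = {x + y |x y. x \<in> ext_gen es \<and> y \<in> (\<lambda>B. mvector e \<and>\<^sub>m B) ` ext_gen es}"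
    by auto
  then show ?case
    using subspace_sums[OF Cons linear_subspace_image[OF linear_wedge_right Cons]] by simp
qed

lemma mscalar_ext_gen: "mscalar c \<in> ext_gen es"
proof (induction es)
  case (Cons e es)
  have "mscalar c = mscalar c + mvector e \<and>\<^sub>m 0" by (simp add: linear_0[OF linear_wedge_right])
  then show ?case
    using Cons subspace_0[OF subspace_ext_gen[of es]] unfolding ext_gen.simps by blast
qed simp

text \<open>Write \<open>v\<close> as \<open>u\<close> plus a multiple of \<open>e\<close>, with
  \<open>u\<close> in the span of the remaining list. The multiple of \<open>e\<close> moves
  \<open>A\<close> into the second slot and kills the term already there, while \<open>u\<close>
  passes \<open>e\<close> at the cost of a sign.\<close>

lemma wedge_ext_gen:
  "v \<in> span (set es) \<Longrightarrow> X \<in> ext_gen es \<Longrightarrow> mvector v \<and>\<^sub>m X \<in> ext_gen es"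
proof (induction es arbitrary: v X)
  case Nil
  then show ?case
    using mscalar_ext_gen[of 0 "[]"]
    by (simp add: linear_0[OF linear_mvector] linear_0[OF linear_wedge_left] linear_0[OF linear_mscalar])
next
  case (Cons e es)
  from Cons.prems(1) obtain k where u: "v - k *\<^sub>R e \<in> span (set es)"
    by (auto simp: span_breakdown_eq)
  define u where "u = v - k *\<^sub>R e"
  have v: "mvector v = mvector u + k *\<^sub>R mvector e"
    by (simp add: u_def mvector_add[symmetric] mvector_scaleR[symmetric])
  from Cons.prems(2) obtain A B where X: "X = A + mvector e \<and>\<^sub>m B" "A \<in> ext_gen es" "B \<in> ext_gen es"
    by auto
  have "mvector e \<and>\<^sub>m mvector e \<and>\<^sub>m B = 0"
    by (simp add: wedge_assoc[symmetric] mvector_square linear_0[OF linear_wedge_left])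
  then have "mvector v \<and>\<^sub>m X = mvector u \<and>\<^sub>m A + mvector e \<and>\<^sub>m (k *\<^sub>R A - mvector u \<and>\<^sub>m B)"
    by (simp add: v X wedge_add_left wedge_add_right wedge_scaleR_left wedge_scaleR_right
        linear_diff[OF linear_wedge_right] mvector_anticommute[of u e])
  moreover have "mvector u \<and>\<^sub>m A \<in> ext_gen es" "k *\<^sub>R A - mvector u \<and>\<^sub>m B \<in> ext_gen es"
    using Cons.IH[OF u[folded u_def]] X
    by (auto intro!: subspace_diff subspace_scale subspace_ext_gen)
  ultimately show ?case by auto
qed

lemma ext_gen_UNIV:
  assumes "span (set es) = UNIV"
  shows "X \<in> ext_gen es"
proof (induction X rule: multivector_induct)
  case (scalar c)
  show ?case by (rule mscalar_ext_gen)
next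
  case (vector v X)
  then show ?case using assms by (intro wedge_ext_gen) auto
next
  case (add X Y)
  then show ?case by (intro subspace_add subspace_ext_gen)
qed

lemma icontr_ext_gen:
  "\<forall>e\<in>set es. inner a e = 0 \<Longrightarrow> X \<in> ext_gen es \<Longrightarrow> icontr a X = 0"
proof (induction es arbitrary: X)
  case (Cons e es)
  then obtain A B where X: "X = A + mvector e \<and>\<^sub>m B" "A \<in> ext_gen es" "B \<in> ext_gen es"
    by auto
  with Cons show ?case
    by (simp add: linear_add[OF linear_icontr] icontr_wedge linear_0[OF linear_wedge_right])
qed auto

text \<open>Contraction by \<open>e\<close> kills \<open>A\<close> and returns a nonzero multiple of
  \<open>B\<close>. Being adjoint to the wedge with \<open>e\<close>, it sends \<open>W\<close> to
  another multivector orthogonal to everything, so \<open>B\<close> vanishes by induction, and then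
  so does \<open>A\<close>. Testing against all \<open>Z\<close>, not only those in
  \<open>ext_gen\<close>, lets the hypothesis pass to \<open>A\<close> and \<open>B\<close>.\<close>

lemma mdot_nondegenerate_ext_gen:
  "distinct es \<Longrightarrow> pairwise (\<lambda>x y. inner x y = 0) (set es) \<Longrightarrow> 0 \<notin> set es \<Longrightarrow>
    W \<in> ext_gen es \<Longrightarrow> (\<And>Z. mdot W Z = 0) \<Longrightarrow> W = 0"
proof (induction es arbitrary: W)
  case Nil
  then obtain c where c: "W = mscalar c" by auto
  then have "c = 0" using Nil(5)[of "mscalar 1"] by (simp add: mdot_mscalar)
  then show ?case by (simp add: c linear_0[OF linear_mscalar])
next
  case (Cons e es)
  have es: "distinct es" "pairwise (\<lambda>x y. inner x y = 0) (set es)" "0 \<notin> set es"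
    using Cons.prems by (auto simp: pairwise_def)
  have orth: "\<forall>f\<in>set es. inner e f = 0"
    using Cons.prems by (auto simp: pairwise_def)
  from Cons.prems obtain A B where W: "W = A + mvector e \<and>\<^sub>m B" "A \<in> ext_gen es" "B \<in> ext_gen es"
    by auto
  have "icontr e W = inner e e *\<^sub>R B"
    using orth W by (simp add: linear_add[OF linear_icontr] icontr_wedge icontr_ext_gen[of es e]
        linear_0[OF linear_wedge_right])
  then have "inner e e *\<^sub>R mdot B Z = 0" for Z
    using mdot_icontr[of e W Z] Cons.prems(5) linear_scale[OF linear_mdot_left] by metis
  then have "mdot B Z = 0" for Z using Cons.prems by simp
  then have "B = 0" using Cons.IH[OF es] W by blast
  then have "W = A" using W by (simp add: linear_0[OF linear_wedge_right])
  then show ?case using Cons.IH[OF es] W Cons.prems(5) by blast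
qed

section \<open>Reversion and contraction from the right\<close>

lemma blade_wedge_mvector:
  "blade vs \<and>\<^sub>m mvector v = (- 1) ^ length vs *\<^sub>R (mvector v \<and>\<^sub>m blade vs)"
proof (induction vs)
  case (Cons w vs)
  then show ?case
    by (simp add: wedge_assoc wedge_scaleR_right mvector_anticommute[of w v])
qed simp

text \<open>For length k the sign is the familiar (-1)^(k(k-1)/2): each vector moves past all those
  that follow it.\<close>

lemma reversion_blade: "reversion (blade vs) = (\<Prod>i<length vs. (- 1) ^ i) *\<^sub>R blade vs"
  by (induction vs)
    (simp_all add: reversion_wedge wedge_scaleR_left blade_wedge_mvector mult.commute)

text \<open>Blades of equal length acquire the same sign, which squares to 1; blades of unequal
  length are orthogonal anyway.\<close>

lemma mdot_reversion: "mdot (reversion X) (reversion Y) = mdot X Y"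
proof -
  have "(\<lambda>X Y. mdot (reversion X) (reversion Y)) = mdot"
  proof (rule bilinear_multivector_eqI[OF _ bilinear_mdot])
    show "bilinear (\<lambda>X Y. mdot (reversion X) (reversion Y))"
      unfolding bilinear_def
      using linear_compose[OF linear_reversion linear_mdot_left, unfolded comp_def]
        linear_compose[OF linear_reversion linear_mdot_right, unfolded comp_def] by blast
    fix vs ws :: "'b list"
    have "(\<Prod>i<k. (- 1) ^ i) * (\<Prod>i<k. (- 1) ^ i) = (1 :: real)" for k :: nat
      by (simp add: prod.distrib[symmetric])
    then show "mdot (reversion (blade vs)) (reversion (blade ws)) = mdot (blade vs) (blade ws)"
      by (cases "length vs = length ws")
        (simp_all add: reversion_blade linear_scale[OF linear_mdot_left]
          linear_scale[OF linear_mdot_right] mdot_blade mult.assoc[symmetric])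
  qed
  then show ?thesis by metis
qed

text \<open>Reversion exchanges left and right multiplication, so conjugating by it gives the
  adjoint of wedging on the right.\<close>

definition icontr_right :: "'a::real_inner \<Rightarrow> 'a multivector \<Rightarrow> 'a multivector" where
  "icontr_right b X = reversion (icontr b (reversion X))"

lemma linear_icontr_right: "linear (icontr_right b)"
  unfolding icontr_right_def[abs_def]
  using linear_compose[OF linear_compose[OF linear_reversion linear_icontr] linear_reversion]
  by (simp add: comp_def)

lemma mdot_icontr_right: "mdot (icontr_right b X) Z = mdot X (Z \<and>\<^sub>m mvector b)"
proof -
  have "mdot (icontr_right b X) Z = mdot (icontr b (reversion X)) (reversion Z)"
    using mdot_reversion[of _ "reversion Z"] by (simp add: icontr_right_def)
  also have "\<dots> = mdot (reversion X) (reversion (Z \<and>\<^sub>m mvector b))"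
    by (simp add: mdot_icontr reversion_wedge)
  finally show ?thesis by (simp add: mdot_reversion)
qed

text \<open>To reach the last factor the contraction passes every vector of \<open>X\<close>; the
  resulting sign is the grade involution, \<open>extended uminus\<close>.\<close>

lemma icontr_wedge_mvector:
  "icontr a (X \<and>\<^sub>m mvector w) = icontr a X \<and>\<^sub>m mvector w + inner a w *\<^sub>R extended uminus X"
proof (induction X rule: multivector_induct)
  case (scalar c)
  have "icontr a (mvector w) = inner a w *\<^sub>R mscalar 1"
    using icontr_wedge[of a w "mscalar 1"] by (simp add: linear_0[OF linear_wedge_right])
  then show ?case
    by (simp add: linear_scale[OF linear_icontr] linear_0[OF linear_wedge_left]
        extended_mscalar[OF linear_uminus]) (simp add: mscalar_eq[of c])
next
  case (vector v X)
  then show ?case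
    by (simp add: wedge_assoc icontr_wedge extended_wedge[OF linear_uminus]
        extended_mvector[OF linear_uminus] linear_neg[OF linear_mvector] linear_neg[OF linear_wedge_left]
        wedge_add_right wedge_scaleR_right wedge_scaleR_left linear_diff[OF linear_wedge_left]
        algebra_simps)
next
  case (add X Y)
  then show ?case
    by (simp add: wedge_add_left linear_add[OF linear_icontr]
        linear_add[OF linear_extended[OF linear_uminus]] algebra_simps)
qed

lemma icontr_right_wedge:
  "icontr_right b (mvector v \<and>\<^sub>m X) = mvector v \<and>\<^sub>m icontr_right b X + inner b v *\<^sub>R extended uminus X"
  by (simp add: icontr_right_def reversion_wedge icontr_wedge_mvector linear_add[OF linear_reversion]
      linear_scale[OF linear_reversion] extended_reversion[OF linear_uminus, symmetric])

section \<open>Finite-dimensional spaces\<close>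

context
  fixes B :: "'a::real_inner set"
  assumes finite: "finite B" and spanning: "span B = UNIV"
begin

lemma orthogonal_basis_list:
  obtains es :: "'a list" where "distinct es" "pairwise (\<lambda>x y. inner x y = 0) (set es)"
    "0 \<notin> set es" "span (set es) = UNIV"
proof -
  obtain C :: "'a set" where C: "finite C" "span C = span B" "pairwise Linear_Algebra.orthogonal C"
    using basis_orthogonal[OF finite] by blast
  \<comment> \<open>The orthogonal set \<open>C\<close> may contain 0; removing it keeps the
    span.\<close>
  obtain es where es: "set es = C - {0}" "distinct es"
    using finite_distinct_list[of "C - {0}"] C by auto
  have "span (set es) = UNIV" using C spanning es by (simp add: span_delete_0)
  moreover have "pairwise (\<lambda>x y. inner x y = 0) (set es)"
    using C(3) es by (auto simp: pairwise_def Linear_Algebra.orthogonal_def)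
  ultimately show ?thesis using es that by auto
qed

text \<open>This gives uniqueness in the definite descriptions of \<open>lcontr\<close> and
  \<open>rcontr\<close>, and lets identities be checked through \<open>mdot\<close>.\<close>

lemma mdot_eqI:
  fixes W W' :: "'a multivector"
  assumes "\<And>Z. mdot W Z = mdot W' Z"
  shows "W = W'"
proof -
  obtain es :: "'a list" where es: "distinct es" "pairwise (\<lambda>x y. inner x y = 0) (set es)"
    "0 \<notin> set es" "span (set es) = UNIV"
    using orthogonal_basis_list .
  have "W - W' = 0"
    using assms
    by (intro mdot_nondegenerate_ext_gen[OF es(1-3) ext_gen_UNIV[OF es(4)]])
      (simp add: linear_diff[OF linear_mdot_left])
  then show ?thesis by simp
qed

section \<open>Adjoints\<close>

lemma inner_adjoint:
  fixes f :: "'a \<Rightarrow> 'a"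
  assumes f: "linear f"
  shows "inner (f x) y = inner x (adjoint f y)"
proof -
  obtain es :: "'a list" where es: "pairwise (\<lambda>x y. inner x y = 0) (set es)"
    "0 \<notin> set es" "span (set es) = UNIV"
    using orthogonal_basis_list .
  \<comment> \<open>\<open>adjoint\<close> is a choice, so some adjoint must be exhibited. This is
    its expansion in the orthogonal basis, divided by squared norms because the basis is not
    normalised.\<close>
  define f' where "f' y = (\<Sum>e\<in>set es. (inner (f e) y / inner e e) *\<^sub>R e)" for y
  have "inner (f x) y = inner x (f' y)" for x y
  proof (rule linear_eq_on[of "\<lambda>x. inner (f x) y" "\<lambda>x. inner x (f' y)" x "set es"])
    show "linear (\<lambda>x. inner (f x) y)"
      by (simp add: linear_iff linear_add[OF f] linear_scale[OF f] inner_add_left)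
    show "linear (\<lambda>x. inner x (f' y))" by (simp add: linear_iff inner_add_left)
    show "x \<in> span (set es)" using es by simp
    fix d assume d: "d \<in> set es"
    have "inner d (f' y) = (\<Sum>e\<in>set es. if e = d then inner (f d) y else 0)"
      unfolding f'_def inner_sum_right
      using es d by (intro sum.cong) (auto simp: pairwise_def)
    then show "inner (f d) y = inner d (f' y)" using d by simp
  qed
  then have "\<exists>f'. \<forall>x y. inner (f x) y = inner x (f' y)" by blast
  then have "\<forall>x y. inner (f x) y = inner x (adjoint f y)"
    unfolding adjoint_def by (rule someI_ex)
  then show ?thesis by blast
qed

lemma linear_adjoint:
  fixes f :: "'a \<Rightarrow> 'a"
  assumes f: "linear f"
  shows "linear (adjoint f)"
proof -
  have "inner x (adjoint f (y + z)) = inner x (adjoint f y + adjoint f z)"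
    "inner x (adjoint f (c *\<^sub>R y)) = inner x (c *\<^sub>R adjoint f y)" for x y z c
    by (simp_all add: inner_add_right inner_adjoint[OF f, symmetric])
  then show ?thesis by (intro linearI) (metis vector_eq_ldot)+
qed

text \<open>On blades, moving \<open>t\<close> across the inner product in every entry leaves the
  Gram matrix unchanged.\<close>

lemma mdot_extended:
  fixes t :: "'a \<Rightarrow> 'a"
  assumes t: "linear t"
  shows "mdot (extended t X) Y = mdot X (extended (adjoint t) Y)"
proof -
  have "(\<lambda>X Y. mdot (extended t X) Y) = (\<lambda>X Y. mdot X (extended (adjoint t) Y))"
  proof (rule bilinear_multivector_eqI)
    note lin = linear_extended[OF t] linear_extended[OF linear_adjoint[OF t]]
    show "bilinear (\<lambda>X Y. mdot (extended t X) Y)" "bilinear (\<lambda>X Y. mdot X (extended (adjoint t) Y))"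
      unfolding bilinear_def
      using linear_compose[OF lin(1) linear_mdot_left, unfolded comp_def] linear_mdot_right
        linear_compose[OF lin(2) linear_mdot_right, unfolded comp_def] linear_mdot_left by blast+
    fix vs ws :: "'a list"
    have "Matrix.mat (length vs) (length ws) (\<lambda>(i, j). inner (map t vs ! i) (ws ! j))
        = Matrix.mat (length vs) (length ws) (\<lambda>(i, j). inner (vs ! i) (map (adjoint t) ws ! j))"
      by (intro eq_matI) (simp_all add: inner_adjoint[OF t])
    then show "mdot (extended t (blade vs)) (blade ws) = mdot (blade vs) (extended (adjoint t) (blade ws))"
      by (cases "length vs = length ws")
        (simp_all add: extended_blade[OF t] extended_blade[OF linear_adjoint[OF t]] mdot_blade)
  qed
  then show ?thesis by metis
qed

lemma lcontr_eq:
  fixes X Y :: "'a multivector"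
  shows "lcontr X Y = icontr.act X Y"
  unfolding lcontr_def
  by (rule the_equality) (auto intro: mdot_eqI simp: mdot_contract)

lemma mdot_lcontr:
  fixes X Y Z :: "'a multivector"
  shows "mdot (lcontr X Y) Z = mdot Y (reversion X \<and>\<^sub>m Z)"
  by (simp add: lcontr_eq mdot_contract)

text \<open>Reversion preserves \<open>mdot\<close> and reverses products, so it carries the
  defining equation of \<open>lcontr\<close> to that of \<open>rcontr\<close>.\<close>

lemma rcontr_eq:
  fixes X Y :: "'a multivector"
  shows "rcontr X Y = reversion (lcontr (reversion Y) (reversion X))"
proof -
  have "mdot (reversion (lcontr (reversion Y) (reversion X))) Z = mdot X (Z \<and>\<^sub>m reversion Y)" for Z
    using mdot_reversion[of "lcontr (reversion Y) (reversion X)" "reversion Z"]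
      mdot_reversion[of X "Z \<and>\<^sub>m reversion Y"]
    by (simp add: mdot_lcontr reversion_wedge)
  then show ?thesis
    unfolding rcontr_def by (intro the_equality) (auto intro: mdot_eqI)
qed

lemma mdot_rcontr:
  fixes X Y Z :: "'a multivector"
  shows "mdot (rcontr X Y) Z = mdot X (Z \<and>\<^sub>m reversion Y)"
  using mdot_reversion[of "lcontr (reversion Y) (reversion X)" "reversion Z"]
    mdot_reversion[of X "Z \<and>\<^sub>m reversion Y"]
  by (simp add: rcontr_eq mdot_lcontr reversion_wedge)

section \<open>Gauge covariance of the scalar and contracted products\<close>

context
  fixes h \<eta> g :: "'a \<Rightarrow> 'a"
  assumes h: "linear h" and \<eta>: "linear \<eta>" and g: "g = adjoint h \<circ> \<eta> \<circ> h"
begin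

lemma extended_gauge: "extended g X = extended (adjoint h) (extended \<eta> (extended h X))"
  unfolding g using h \<eta> linear_adjoint[OF h] by (simp add: extended_comp linear_compose)

lemma gdot_gauge: "gdot g X Y = gdot \<eta> (extended h X) (extended h Y)"
proof -
  have "gdot g X Y = mdot Y (extended (adjoint h) (extended \<eta> (extended h X)))"
    by (simp add: gdot_def extended_gauge mdot_commute)
  also have "\<dots> = mdot (extended h Y) (extended \<eta> (extended h X))"
    by (rule mdot_extended[OF h, symmetric])
  finally show ?thesis by (simp add: gdot_def mdot_commute)
qed

text \<open>Tested against \<open>Z\<close>, the outer \<open>extended h\<close> becomes
  \<open>extended (adjoint h)\<close> on \<open>Z\<close>. It joins the same factor coming from
  \<open>g\<close>, and moving both back together puts \<open>extended h\<close> on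
  \<open>Y\<close>.\<close>

lemma glcontr_gauge: "extended h (glcontr g X Y) = glcontr \<eta> (extended h X) (extended h Y)"
  by (rule mdot_eqI)
    (simp add: glcontr_def mdot_extended[OF h] mdot_lcontr extended_gauge
      extended_wedge[OF linear_adjoint[OF h]] extended_reversion[OF linear_adjoint[OF h]])

lemma grcontr_gauge: "extended h (grcontr g X Y) = grcontr \<eta> (extended h X) (extended h Y)"
  by (rule mdot_eqI)
    (simp add: grcontr_def mdot_extended[OF h] mdot_rcontr extended_gauge
      extended_wedge[OF linear_adjoint[OF h]] extended_reversion[OF linear_adjoint[OF h]])

end

lemma glcontr_mvector:
  fixes t :: "'a \<Rightarrow> 'a"
  assumes "linear t"
  shows "glcontr t (mvector v) X = icontr (t v) X"
  by (simp add: glcontr_def extended_mvector[OF assms] lcontr_eq icontr.act_mvector)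

lemma grcontr_mvector:
  fixes t :: "'a \<Rightarrow> 'a"
  assumes "linear t"
  shows "grcontr t X (mvector v) = icontr_right (t v) X"
  by (simp add: grcontr_def extended_mvector[OF assms] rcontr_eq lcontr_eq icontr.act_mvector
      icontr_right_def)

text \<open>The two contractions are adjoint to left and right wedging, which commute by
  associativity.\<close>

lemma icontr_icontr_right:
  fixes X :: "'a multivector"
  shows "icontr a (icontr_right b X) = icontr_right b (icontr a X)"
  by (rule mdot_eqI) (simp add: mdot_icontr mdot_icontr_right wedge_assoc)

end

section \<open>The Clifford product\<close>

text \<open>The prescribed Clifford multiplication by a vector, available before any Clifford
  product is known to exist.\<close>

definition cliff_left :: "('a::real_inner \<Rightarrow> 'a) \<Rightarrow> 'a \<Rightarrow> 'a multivector \<Rightarrow> 'a multivector" where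
  "cliff_left t v X = icontr (t v) X + mvector v \<and>\<^sub>m X"

definition cliff_right :: "('a::real_inner \<Rightarrow> 'a) \<Rightarrow> 'a \<Rightarrow> 'a multivector \<Rightarrow> 'a multivector" where
  "cliff_right t v X = icontr_right (t v) X + X \<and>\<^sub>m mvector v"

lemma linear_cliff_left: "linear (cliff_left t v)"
  unfolding cliff_left_def[abs_def]
  by (intro linear_compose_add linear_icontr linear_wedge_right)

lemma linear_cliff_right: "linear (cliff_right t v)"
  unfolding cliff_right_def[abs_def]
  by (intro linear_compose_add linear_icontr_right linear_wedge_left)

lemma reversion_cliff_left: "reversion (cliff_left t v X) = cliff_right t v (reversion X)"
  by (simp add: cliff_left_def cliff_right_def icontr_right_def reversion_wedge
      linear_add[OF linear_reversion])

lemma cliff_left_one: "cliff_left t v (mscalar 1) = mvector v"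
  by (simp add: cliff_left_def)

lemma cliff_right_one: "cliff_right t v (mscalar 1) = mvector v"
  using reversion_cliff_left[of t v "mscalar 1"] by (simp add: cliff_left_one)

text \<open>A blade differs from \<open>cliff_left\<close> applied to its tail by a contraction,
  which is a combination of shorter blades; hence the induction on length.\<close>

lemma cliff_left_generates:
  assumes U: "subspace U" and one: "mscalar 1 \<in> U"
    and closed: "\<And>v X. X \<in> U \<Longrightarrow> cliff_left t v X \<in> U"
  shows "X \<in> U"
proof -
  have blade: "blade vs \<in> U" for vs
  proof (induction vs rule: length_induct)
    case (1 vs)
    show ?case
    proof (cases vs)
      case Nil
      then show ?thesis using one by simp
    next
      case (Cons v ws)
      have "icontr (t v) (blade ws) \<in> U"
        unfolding icontr_blade using 1 Cons
        by (intro subspace_sum[OF U] subspace_scale[OF U]) auto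
      moreover have "cliff_left t v (blade ws) \<in> U" using 1 Cons by (intro closed) auto
      moreover have "blade vs = cliff_left t v (blade ws) - icontr (t v) (blade ws)"
        by (simp add: cliff_left_def Cons)
      ultimately show ?thesis using subspace_diff[OF U] by metis
    qed
  qed
  show ?thesis
    by (induction X rule: multivector_induct_blade)
      (auto intro: subspace_scale[OF U] subspace_add[OF U] blade)
qed

text \<open>The predicate under the definite description in \<open>clifford\<close>, named so that
  existence and uniqueness can be treated separately.\<close>

definition clifford_product ::
    "('a::real_inner \<Rightarrow> 'a) \<Rightarrow> ('a multivector \<Rightarrow> 'a multivector \<Rightarrow> 'a multivector) \<Rightarrow> bool" where
  "clifford_product g P \<longleftrightarrow> bilinear P \<and> (\<forall>X Y Z. P (P X Y) Z = P X (P Y Z)) \<and>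
     (\<forall>\<alpha> X. P (mscalar \<alpha>) X = \<alpha> *\<^sub>R X \<and> P X (mscalar \<alpha>) = \<alpha> *\<^sub>R X) \<and>
     (\<forall>v X. P (mvector v) X = glcontr g (mvector v) X + mvector v \<and>\<^sub>m X) \<and>
     (\<forall>v X. P X (mvector v) = grcontr g X (mvector v) + X \<and>\<^sub>m mvector v)"

text \<open>The operators commuting with all right multiplications by vectors are to become the left
  multiplications of the Clifford algebra: such an operator is determined by its value at 1, and
  every multivector occurs as such a value, so composition of operators transfers to an associative
  product of multivectors.\<close>

definition cliff_ops :: "('a::real_inner \<Rightarrow> 'a) \<Rightarrow> ('a multivector \<Rightarrow> 'a multivector) set" where
  "cliff_ops t = {A. linear A \<and> (\<forall>w X. A (cliff_right t w X) = cliff_right t w (A X))}"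

lemma cliff_ops_eqI:
  assumes "A \<in> cliff_ops t" "A' \<in> cliff_ops t" "A (mscalar 1) = A' (mscalar 1)"
  shows "A = A'"
proof
  fix X
  \<comment> \<open>The operators commute with \<open>cliff_right\<close>, whereas generation is
    known for \<open>cliff_left\<close>; reversion exchanges the two.\<close>
  let ?U = "{Y. A (reversion Y) = A' (reversion Y)}"
  have lin: "linear A" "linear A'" using assms by (auto simp: cliff_ops_def)
  have "reversion X \<in> ?U"
  proof (rule cliff_left_generates)
    show "subspace ?U"
      by (rule subspaceI)
        (auto simp: linear_0[OF linear_reversion] linear_add[OF linear_reversion]
          linear_scale[OF linear_reversion] linear_0[OF lin(1)] linear_0[OF lin(2)] linear_add[OF lin(1)]
          linear_add[OF lin(2)] linear_scale[OF lin(1)] linear_scale[OF lin(2)])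
    show "mscalar 1 \<in> ?U" using assms by simp
    show "cliff_left t v Y \<in> ?U" if "Y \<in> ?U" for v Y
      using that assms by (simp add: reversion_cliff_left cliff_ops_def)
  qed
  then show "A X = A' X" by simp
qed

context
  fixes B :: "'a::real_inner set" and t :: "'a \<Rightarrow> 'a"
  assumes finite: "finite B" and spanning: "span B = UNIV"
    and t: "linear t" and symmetric: "\<And>v w. inner (t v) w = inner v (t w)"
begin

lemma clifford_product_iff:
  "clifford_product t P \<longleftrightarrow> bilinear P \<and> (\<forall>X Y Z. P (P X Y) Z = P X (P Y Z)) \<and>
     (\<forall>\<alpha> X. P (mscalar \<alpha>) X = \<alpha> *\<^sub>R X \<and> P X (mscalar \<alpha>) = \<alpha> *\<^sub>R X) \<and>
     (\<forall>v X. P (mvector v) X = cliff_left t v X) \<and> (\<forall>v X. P X (mvector v) = cliff_right t v X)"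
  unfolding clifford_product_def cliff_left_def cliff_right_def
  by (simp add: glcontr_mvector[OF finite spanning t] grcontr_mvector[OF finite spanning t])

text \<open>Apart from terms that match by associativity or \<open>icontr_icontr_right\<close>, each
  side has one multiple of \<open>extended uminus X\<close>. The coefficients
  \<open>inner (t v) w\<close> and \<open>inner (t w) v\<close> agree because \<open>t\<close> is
  symmetric.\<close>

lemma cliff_left_right_commute:
  "cliff_left t v (cliff_right t w X) = cliff_right t w (cliff_left t v X)"
  using symmetric[of v w]
  by (simp add: cliff_left_def cliff_right_def linear_add[OF linear_icontr]
      linear_add[OF linear_icontr_right] wedge_add_left wedge_add_right icontr_wedge_mvector
      icontr_right_wedge icontr_icontr_right[OF finite spanning] wedge_assoc
      inner_commute[of v "t w"] algebra_simps)

lemma clifford_product_unique: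
  assumes P: "clifford_product t P" and Q: "clifford_product t Q"
  shows "P = Q"
proof (intro ext)
  fix X Y
  let ?U = "{X. \<forall>Y. P X Y = Q X Y}"
  have bil: "bilinear P" "bilinear Q" using P Q by (auto simp: clifford_product_iff)
  have "X \<in> ?U"
  proof (rule cliff_left_generates)
    show "subspace ?U"
      by (rule subspaceI)
        (auto simp: bilinear_lzero[OF bil(1)] bilinear_lzero[OF bil(2)] bilinear_ladd[OF bil(1)]
          bilinear_ladd[OF bil(2)] bilinear_lmul[OF bil(1)] bilinear_lmul[OF bil(2)])
    show "mscalar 1 \<in> ?U" using P Q by (simp add: clifford_product_iff)
    show "cliff_left t v Z \<in> ?U" if "Z \<in> ?U" for v Z
    proof -
      \<comment> \<open>Associativity with a vector as first factor: left multiplication by it is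
        \<open>cliff_left\<close> for every Clifford product.\<close>
      have "R (cliff_left t v Z) Y = cliff_left t v (R Z Y)" if "clifford_product t R" for R Y
        using that unfolding clifford_product_iff by metis
      from this[OF P] this[OF Q] show ?thesis using that by simp
    qed
  qed
  then show "P X Y = Q X Y" by blast
qed

text \<open>The attained values form a subspace containing 1. It is closed under
  \<open>cliff_left\<close>, since composing with \<open>cliff_left t v\<close> stays in the
  commutant by \<open>cliff_left_right_commute\<close>.\<close>

lemma cliff_ops_value: "\<exists>A\<in>cliff_ops t. A (mscalar 1) = X"
proof -
  let ?U = "(\<lambda>A. A (mscalar 1)) ` cliff_ops t"
  have "X \<in> ?U"
  proof (rule cliff_left_generates)
    show "subspace ?U"
    proof (rule subspaceI)
      have "(\<lambda>X. 0) \<in> cliff_ops t"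
        by (simp add: cliff_ops_def linear_zero linear_0[OF linear_cliff_right])
      then show "0 \<in> ?U" by (rule rev_image_eqI) simp
    next
      fix Y Z assume "Y \<in> ?U" "Z \<in> ?U"
      then obtain A A' where A: "A \<in> cliff_ops t" "A' \<in> cliff_ops t"
        and YZ: "Y = A (mscalar 1)" "Z = A' (mscalar 1)" by blast
      have "(\<lambda>X. A X + A' X) \<in> cliff_ops t"
        using A by (simp add: cliff_ops_def linear_compose_add linear_add[OF linear_cliff_right])
      then show "Y + Z \<in> ?U" by (rule rev_image_eqI) (simp add: YZ)
    next
      fix c Y assume "Y \<in> ?U"
      then obtain A where A: "A \<in> cliff_ops t" and Y: "Y = A (mscalar 1)" by blast
      have "(\<lambda>X. c *\<^sub>R A X) \<in> cliff_ops t"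
        using A by (simp add: cliff_ops_def linear_compose_scale_right linear_scale[OF linear_cliff_right])
      then show "c *\<^sub>R Y \<in> ?U" by (rule rev_image_eqI) (simp add: Y)
    qed
    have "(\<lambda>X. X) \<in> cliff_ops t" by (simp add: cliff_ops_def linear_ident)
    then show "mscalar 1 \<in> ?U" by (rule rev_image_eqI) simp
    show "cliff_left t v Y \<in> ?U" if "Y \<in> ?U" for v Y
    proof -
      from that obtain A where A: "A \<in> cliff_ops t" and Y: "Y = A (mscalar 1)" by blast
      have "cliff_left t v \<circ> A \<in> cliff_ops t"
        using A by (simp add: cliff_ops_def linear_compose linear_cliff_left cliff_left_right_commute)
      then show ?thesis by (rule rev_image_eqI) (simp add: Y)
    qed
  qed
  then show ?thesis by blast
qed

lemma clifford_product_exists: "\<exists>P. clifford_product t P"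
proof -
  \<comment> \<open>\<open>op X\<close> will be left multiplication by \<open>X\<close>, so
    \<open>op\<close> itself is the product.\<close>
  obtain op where op: "op X \<in> cliff_ops t" and op_one: "op X (mscalar 1) = X" for X
    using cliff_ops_value by metis
  have lin: "linear (op X)" for X using op[of X] by (simp add: cliff_ops_def)
  have op_eqI: "op X = A" if "A \<in> cliff_ops t" "A (mscalar 1) = X" for A X
    using cliff_ops_eqI[OF op that(1)] op_one that(2) by simp
  have op_add: "op (X + Y) = (\<lambda>Z. op X Z + op Y Z)" for X Y
    using op[of X] op[of Y]
    by (intro op_eqI) (simp_all add: op_one cliff_ops_def linear_compose_add linear_add[OF linear_cliff_right])
  have op_scale: "op (c *\<^sub>R X) = (\<lambda>Z. c *\<^sub>R op X Z)" for c X
    using op[of X]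
    by (intro op_eqI) (simp_all add: op_one cliff_ops_def linear_compose_scale_right
        linear_scale[OF linear_cliff_right])
  \<comment> \<open>Both operators lie in the commutant and take 1 to \<open>op X Y\<close>. This is
    associativity.\<close>
  have op_op: "op (op X Y) = op X \<circ> op Y" for X Y
    using op[of X] op[of Y]
    by (intro op_eqI) (simp_all add: op_one cliff_ops_def linear_compose)
  have op_mvector: "op (mvector v) = cliff_left t v" for v
    by (rule op_eqI) (simp_all add: cliff_ops_def linear_cliff_left cliff_left_right_commute cliff_left_one)
  have op_scalar: "op (mscalar c) = (\<lambda>X. c *\<^sub>R X)" for c
    by (rule op_eqI) (simp_all add: cliff_ops_def linear_scale_self linear_scale[OF linear_cliff_right]
        mscalar_eq[symmetric])
  have "op X (mvector v) = cliff_right t v X" for X v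
  proof -
    \<comment> \<open>Commutation with \<open>cliff_right\<close>, evaluated at 1, gives the rule
      for a vector as right factor.\<close>
    have "op X (cliff_right t v (mscalar 1)) = cliff_right t v (op X (mscalar 1))"
      using op[of X] by (simp add: cliff_ops_def)
    then show ?thesis by (simp add: cliff_right_one op_one)
  qed
  moreover have "op X (mscalar c) = c *\<^sub>R X" for X c
    by (simp add: mscalar_eq[of c] linear_scale[OF lin] op_one)
  moreover have "bilinear op"
    by (simp add: bilinear_def lin) (simp add: linear_iff op_add op_scale)
  ultimately have "clifford_product t op"
    unfolding clifford_product_iff by (simp add: op_op op_mvector op_scalar)
  then show ?thesis by blast
qed

lemma clifford_product_clifford: "clifford_product t (clifford t)"
proof -
  have "clifford t = (THE P. clifford_product t P)"
    unfolding clifford_def clifford_product_def ..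
  then show ?thesis
    using theI'[of "clifford_product t"] clifford_product_exists clifford_product_unique by metis
qed

end

section \<open>Transport of the Clifford product along the gauge\<close>

lemma linear_inv_bij:
  assumes "linear h" "bij h"
  shows "linear (Hilbert_Choice.inv h)"
proof -
  have "h (Hilbert_Choice.inv h x) = x" for x
    using assms(2) by (simp add: bij_is_surj surj_f_inv_f)
  then show ?thesis
    by (intro linearI; intro injD[OF bij_is_inj[OF assms(2)]])
      (simp_all add: linear_add[OF assms(1)] linear_scale[OF assms(1)])
qed

text \<open>Conjugation by the invertible \<open>extended h\<close> keeps bilinearity, associativity
  and the action of scalars. The rules for vectors change from \<eta> to \<open>g\<close> by
  \<open>glcontr_gauge\<close> and \<open>grcontr_gauge\<close>.\<close>

lemma clifford_product_gauge:
  fixes B :: "'a::real_inner set" and g \<eta> h :: "'a \<Rightarrow> 'a"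
  assumes B: "finite B" "span B = UNIV"
    and h: "linear h" "bij h" and \<eta>: "linear \<eta>" and g: "g = adjoint h \<circ> \<eta> \<circ> h"
    and P: "clifford_product \<eta> P"
  shows "clifford_product g (\<lambda>X Y. extended (Hilbert_Choice.inv h) (P (extended h X) (extended h Y)))"
proof -
  let ?H = "extended h" and ?K = "extended (Hilbert_Choice.inv h)"
  have k: "linear (Hilbert_Choice.inv h)"
    using h by (rule linear_inv_bij)
  have comps: "h \<circ> Hilbert_Choice.inv h = id" "Hilbert_Choice.inv h \<circ> h = id"
    using h(2) by (simp_all add: bij_is_surj surj_iff[symmetric] bij_is_inj)
  have HK [simp]: "?H (?K X) = X" and KH [simp]: "?K (?H X) = X" for X
    using comps extended_comp[OF h(1) k] extended_comp[OF k h(1)] extended_id by metis+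
  note linH = linear_extended[OF h(1)] and linK = linear_extended[OF k]
  have bil: "bilinear P" using P by (simp add: clifford_product_def)
  have bilP: "bilinear (\<lambda>X Y. ?K (P (?H X) (?H Y)))"
    by (auto simp: bilinear_def linear_iff linear_add[OF linH] linear_add[OF linK]
        linear_scale[OF linH] linear_scale[OF linK] bilinear_ladd[OF bil] bilinear_radd[OF bil]
        bilinear_lmul[OF bil] bilinear_rmul[OF bil])
  have left: "P (?H (mvector v)) (?H X) = ?H (glcontr g (mvector v) X + mvector v \<and>\<^sub>m X)" for v X
    using P unfolding clifford_product_def
    by (simp add: linear_add[OF linH] glcontr_gauge[OF B h(1) \<eta> g] extended_wedge[OF h(1)]
        extended_mvector[OF h(1)])
  have right: "P (?H X) (?H (mvector v)) = ?H (grcontr g X (mvector v) + X \<and>\<^sub>m mvector v)" for v X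
    using P unfolding clifford_product_def
    by (simp add: linear_add[OF linH] grcontr_gauge[OF B h(1) \<eta> g] extended_wedge[OF h(1)]
        extended_mvector[OF h(1)])
  show ?thesis
    unfolding clifford_product_def left right
    using P bilP by (simp add: clifford_product_def extended_mscalar[OF h(1)] linear_scale[OF linK])
qed

theorem mainTheorem1:
  fixes g \<eta> h :: "'a::real_inner \<Rightarrow> 'a" and n :: nat
  assumes "\<exists>B :: 'a set. finite B \<and> independent B \<and> span B = UNIV \<and> card B = n"
    and "metric_extensor g"
    and "pseudo_orthogonal \<eta>"
    and "signature \<eta> = signature g"
    and "gauge_extensor g h"
    and "g = adjoint h \<circ> \<eta> \<circ> h"
  shows "\<forall>X Y :: 'a multivector.
      extended h (X \<and>\<^sub>m Y) = extended h X \<and>\<^sub>m extended h Y \<and>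
      extended h (mscalar (gdot g X Y)) = mscalar (gdot \<eta> (extended h X) (extended h Y)) \<and>
      extended h (glcontr g X Y) = glcontr \<eta> (extended h X) (extended h Y) \<and>
      extended h (grcontr g X Y) = grcontr \<eta> (extended h X) (extended h Y) \<and>
      extended h (clifford g X Y) = clifford \<eta> (extended h X) (extended h Y)"
proof -
  obtain B :: "'a set" where B: "finite B" "span B = UNIV" using assms(1) by blast
  have h: "linear h" "bij h" using assms(5) by (simp_all add: gauge_extensor_def)
  have \<eta>: "linear \<eta>" "adjoint \<eta> = \<eta>" and g_linear: "linear g" and g_adj: "adjoint g = g"
    using assms(2,3) by (simp_all add: pseudo_orthogonal_def metric_extensor_def)
  have sym: "inner (\<eta> v) w = inner v (\<eta> w)" "inner (g v) w = inner v (g w)" for v w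
    using inner_adjoint[OF B \<eta>(1)] inner_adjoint[OF B g_linear] \<eta>(2) g_adj by simp_all
  \<comment> \<open>The right-hand side is a Clifford product for \<open>g\<close>, so uniqueness
    identifies it; applying \<open>extended h\<close> then cancels the outer inverse.\<close>
  have "clifford g = (\<lambda>X Y. extended (Hilbert_Choice.inv h) (clifford \<eta> (extended h X) (extended h Y)))"
    using clifford_product_unique[OF B g_linear sym(2) clifford_product_clifford[OF B g_linear sym(2)]
        clifford_product_gauge[OF B h \<eta>(1) assms(6) clifford_product_clifford[OF B \<eta>(1) sym(1)]]] .
  moreover have "extended h (extended (Hilbert_Choice.inv h) X) = X" for X
    using extended_comp[OF h(1) linear_inv_bij[OF h], of X]
      surj_iff[THEN iffD1, OF bij_is_surj[OF h(2)]] by (simp add: extended_id)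
  ultimately show ?thesis
    by (simp add: extended_wedge[OF h(1)] extended_mscalar[OF h(1)]
        gdot_gauge[OF B h(1) \<eta>(1) assms(6)] glcontr_gauge[OF B h(1) \<eta>(1) assms(6)]
        grcontr_gauge[OF B h(1) \<eta>(1) assms(6)])
qed

end
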